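(* If a 3-dimensional quasi-para-Sasakian manifold $(M,\varphi,\eta,\xi,g)$ has $\eta$-parallel Ricci tensor, then its scalar curvature $\mathrm{scal}$ is constant.
   Context: An almost paracontact metric manifold $(M,\varphi,\eta,\xi,g)$ is a smooth manifold $M$ of dimension $2n+1$ ($n\ge 1$; here $n=1$) with a $(1,1)$-tensor field $\varphi$, a vector field $\xi$, a 1-form $\eta$ and a pseudo-Riemannian metric $g$ such that $\varphi\xi=0$, $\eta\circ\varphi=0$, $\eta(\xi)=1$, $\varphi^2=\mathrm{id}-\eta\otimes\xi$, $\varphi$ induces an almost paracomplex structure on each fibre of $\mathbb D=\ker\eta$, and $g(\varphi X,\varphi Y)=-g(X,Y)+\eta(X)\eta(Y)$ for all $X,Y$ (hence $\eta(X)=g(X,\xi)$ and $g$ has signature $(n+1,n)$). It is quasi-para-Sasakian if $(\nabla_X\varphi)Y=g(X,Y)\xi-\eta(Y)X$ for all vector fields $X,Y$, where $\nabla$ is the Levi-Civita connection of $g$. The curvature tensor is $R(X,Y)Z=\nabla_X\nabla_YZ-\nabla_Y\nabla_XZ-\nabla_{[X,Y]}Z$, $\mathrm{Ric}(Y,Z)=\mathrm{tr}(X\mapsto R(X,Y)Z)$, and $\mathrm{scal}$ is the $g$-trace of $\mathrm{Ric}$. The Ricci tensor is called $\eta$-parallel if $(\nabla_X\mathrm{Ric})(\varphi Y,\varphi Z)=0$ for all vector fields $X,Y,Z$.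
   Formalization: The manifold M is assumed to be connected; on a disconnected M the scalar curvature is only constant on each component (a disjoint union of two such manifolds with different constant scalar curvatures is a counterexample). *)

theory Defs
  imports "HOL-Analysis.Analysis" "HOL-Library.Function_Algebras"
begin

section \<open>Smooth manifolds\<close>

text \<open>Meant for open \<open>S\<close>: all iterated directional derivatives up to order \<open>k\<close> exist and are
  continuous on \<open>S\<close>.\<close>

primrec Ck_on :: "nat \<Rightarrow> 'a::real_normed_vector set \<Rightarrow> ('a \<Rightarrow> 'b::real_normed_vector) \<Rightarrow> bool" where
  "Ck_on 0 S f \<longleftrightarrow> continuous_on S f"
| "Ck_on (Suc k) S f \<longleftrightarrow>
     (\<forall>x\<in>S. f differentiable (at x)) \<and> (\<forall>v. Ck_on k S (\<lambda>x. frechet_derivative f (at x) v))"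

definition smooth_on :: "'a::real_normed_vector set \<Rightarrow> ('a \<Rightarrow> 'b::real_normed_vector) \<Rightarrow> bool" where
  "smooth_on S f \<longleftrightarrow> (\<forall>k. Ck_on k S f)"

text \<open>A manifold is the whole of the type \<open>'m\<close>, equipped with an atlas. A chart is a pair \<open>(U, c)\<close>
  of its domain and its coordinate map; only the values of \<open>c\<close> on \<open>U\<close> matter. The atlas need not be
  maximal.\<close>

type_synonym ('m, 'e) chart = "'m set \<times> ('m \<Rightarrow> 'e)"

definition is_chart :: "('m::topological_space, 'e::euclidean_space) chart \<Rightarrow> bool" where
  "is_chart = (\<lambda>(U, c). open U \<and> open (c ` U) \<and> homeomorphism U (c ` U) c (inv_into U c))"

definition compatible ::
    "('m::topological_space, 'e::euclidean_space) chart \<Rightarrow> ('m, 'e) chart \<Rightarrow> bool" where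
  "compatible = (\<lambda>(U, c) (V, d). smooth_on (c ` (U \<inter> V)) (d \<circ> inv_into U c))"

definition smooth_manifold ::
    "('m::{t2_space, second_countable_topology}, 'e::euclidean_space) chart set \<Rightarrow> bool" where
  "smooth_manifold A \<longleftrightarrow>
     (\<forall>k\<in>A. is_chart k) \<and> (\<Union>k\<in>A. fst k) = UNIV \<and> (\<forall>k\<in>A. \<forall>l\<in>A. compatible k l)"

definition smooth_functions :: "('m::topological_space, 'e::euclidean_space) chart set \<Rightarrow> ('m \<Rightarrow> real) set"
  where "smooth_functions A = {f. \<forall>(U, c)\<in>A. smooth_on (c ` U) (f \<circ> inv_into U c)}"

section \<open>Tangent vectors and vector fields\<close>

text \<open>Tangent vectors at \<open>p\<close> are the derivations at \<open>p\<close> of the algebra of smooth functions. They are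
  set to 0 on non-smooth functions, so that equality of tangent vectors is equality in HOL. Sums,
  differences and products of functions are pointwise.\<close>

type_synonym 'm tangent = "('m \<Rightarrow> real) \<Rightarrow> real"
type_synonym 'm vfield = "'m \<Rightarrow> 'm tangent"

definition tangent_space ::
    "('m::topological_space, 'e::euclidean_space) chart set \<Rightarrow> 'm \<Rightarrow> 'm tangent set" where
  "tangent_space A p = {v.
     (\<forall>f\<in>smooth_functions A. \<forall>h\<in>smooth_functions A. v (f + h) = v f + v h) \<and>
     (\<forall>f\<in>smooth_functions A. \<forall>a. v (\<lambda>x. a * f x) = a * v f) \<and>
     (\<forall>f\<in>smooth_functions A. \<forall>h\<in>smooth_functions A. v (f * h) = f p * v h + h p * v f) \<and>
     (\<forall>f. f \<notin> smooth_functions A \<longrightarrow> v f = 0)}"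

definition scale :: "real \<Rightarrow> ('a \<Rightarrow> real) \<Rightarrow> 'a \<Rightarrow> real" where
  "scale a v = (\<lambda>f. a * v f)"

global_interpretation functional: vector_space "scale :: real \<Rightarrow> ('a \<Rightarrow> real) \<Rightarrow> 'a \<Rightarrow> real"
  by unfold_locales (auto simp: scale_def fun_eq_iff algebra_simps)

definition vector_fields ::
    "('m::topological_space, 'e::euclidean_space) chart set \<Rightarrow> 'm vfield set" where
  "vector_fields A = {X. (\<forall>p. X p \<in> tangent_space A p) \<and>
     (\<forall>f\<in>smooth_functions A. (\<lambda>p. X p f) \<in> smooth_functions A)}"

definition scale_field :: "('m \<Rightarrow> real) \<Rightarrow> 'm vfield \<Rightarrow> 'm vfield" where
  "scale_field f X = (\<lambda>p. scale (f p) (X p))"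

definition lie_bracket :: "'m vfield \<Rightarrow> 'm vfield \<Rightarrow> 'm vfield" where
  "lie_bracket X Y = (\<lambda>p f. X p (\<lambda>q. Y q f) - Y p (\<lambda>q. X q f))"

section \<open>Linear algebra in a tangent space\<close>

definition linear_on_space :: "('a \<Rightarrow> real) set \<Rightarrow> (('a \<Rightarrow> real) \<Rightarrow> ('b \<Rightarrow> real)) \<Rightarrow> bool" where
  "linear_on_space V L \<longleftrightarrow>
     (\<forall>v\<in>V. \<forall>w\<in>V. L (v + w) = L v + L w) \<and> (\<forall>v\<in>V. \<forall>a. L (scale a v) = scale a (L v))"

definition linear_form_on :: "('a \<Rightarrow> real) set \<Rightarrow> (('a \<Rightarrow> real) \<Rightarrow> real) \<Rightarrow> bool" where
  "linear_form_on V l \<longleftrightarrow>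
     (\<forall>v\<in>V. \<forall>w\<in>V. l (v + w) = l v + l w) \<and> (\<forall>v\<in>V. \<forall>a. l (scale a v) = a * l v)"

text \<open>The trace of an endomorphism of a finite-dimensional subspace \<open>V\<close>, computed in an arbitrary
  basis.\<close>

definition trace_on :: "('a \<Rightarrow> real) set \<Rightarrow> (('a \<Rightarrow> real) \<Rightarrow> ('a \<Rightarrow> real)) \<Rightarrow> real" where
  "trace_on V L =
     (let B = (SOME B. functional.independent B \<and> functional.span B = V)
      in \<Sum>b\<in>B. functional.representation B (L b) b)"

text \<open>The \<open>g\<close>-trace of a bilinear form \<open>b\<close> is the trace of the endomorphism \<open>Q\<close> of \<open>V\<close> determined
  by \<open>g (Q v) w = b v w\<close>.\<close>

definition metric_trace_on :: "('a \<Rightarrow> real) set \<Rightarrow> (('a \<Rightarrow> real) \<Rightarrow> ('a \<Rightarrow> real) \<Rightarrow> real) \<Rightarrow>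
    (('a \<Rightarrow> real) \<Rightarrow> ('a \<Rightarrow> real) \<Rightarrow> real) \<Rightarrow> real" where
  "metric_trace_on V g b = trace_on V (\<lambda>v. THE u. u \<in> V \<and> (\<forall>w\<in>V. g u w = b v w))"

section \<open>Tensor fields and connections\<close>

text \<open>Tensor fields are families of maps on the tangent spaces; their values outside the tangent
  spaces are irrelevant.\<close>

type_synonym 'm tensor01 = "'m \<Rightarrow> 'm tangent \<Rightarrow> real"
type_synonym 'm tensor02 = "'m \<Rightarrow> 'm tangent \<Rightarrow> 'm tangent \<Rightarrow> real"
type_synonym 'm tensor11 = "'m \<Rightarrow> 'm tangent \<Rightarrow> 'm tangent"
type_synonym 'm connection = "'m vfield \<Rightarrow> 'm vfield \<Rightarrow> 'm vfield"

abbreviation app01 :: "'m tensor01 \<Rightarrow> 'm vfield \<Rightarrow> 'm \<Rightarrow> real" where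
  "app01 \<omega> X \<equiv> (\<lambda>p. \<omega> p (X p))"

abbreviation app02 :: "'m tensor02 \<Rightarrow> 'm vfield \<Rightarrow> 'm vfield \<Rightarrow> 'm \<Rightarrow> real" where
  "app02 T X Y \<equiv> (\<lambda>p. T p (X p) (Y p))"

abbreviation app11 :: "'m tensor11 \<Rightarrow> 'm vfield \<Rightarrow> 'm vfield" where
  "app11 T X \<equiv> (\<lambda>p. T p (X p))"

definition one_form ::
    "('m::topological_space, 'e::euclidean_space) chart set \<Rightarrow> 'm tensor01 \<Rightarrow> bool" where
  "one_form A \<omega> \<longleftrightarrow> (\<forall>p. linear_form_on (tangent_space A p) (\<omega> p)) \<and>
     (\<forall>X\<in>vector_fields A. app01 \<omega> X \<in> smooth_functions A)"

definition endomorphism_field ::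
    "('m::topological_space, 'e::euclidean_space) chart set \<Rightarrow> 'm tensor11 \<Rightarrow> bool" where
  "endomorphism_field A T \<longleftrightarrow>
     (\<forall>p. linear_on_space (tangent_space A p) (T p) \<and>
          (\<forall>v\<in>tangent_space A p. T p v \<in> tangent_space A p)) \<and>
     (\<forall>X\<in>vector_fields A. app11 T X \<in> vector_fields A)"

definition pseudo_riemannian_metric ::
    "('m::topological_space, 'e::euclidean_space) chart set \<Rightarrow> 'm tensor02 \<Rightarrow> bool" where
  "pseudo_riemannian_metric A g \<longleftrightarrow>
     (\<forall>p. \<forall>v\<in>tangent_space A p.
        linear_form_on (tangent_space A p) (g p v) \<and>
        (\<forall>w\<in>tangent_space A p. g p v w = g p w v) \<and>
        ((\<forall>w\<in>tangent_space A p. g p v w = 0) \<longrightarrow> v = 0)) \<and>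
     (\<forall>X\<in>vector_fields A. \<forall>Y\<in>vector_fields A. app02 g X Y \<in> smooth_functions A)"

definition affine_connection ::
    "('m::topological_space, 'e::euclidean_space) chart set \<Rightarrow> 'm connection \<Rightarrow> bool" where
  "affine_connection A nabla \<longleftrightarrow>
     (\<forall>X\<in>vector_fields A. \<forall>Y\<in>vector_fields A. nabla X Y \<in> vector_fields A) \<and>
     (\<forall>X\<in>vector_fields A. \<forall>Y\<in>vector_fields A. \<forall>Z\<in>vector_fields A.
        nabla (X + Y) Z = nabla X Z + nabla Y Z \<and> nabla X (Y + Z) = nabla X Y + nabla X Z) \<and>
     (\<forall>f\<in>smooth_functions A. \<forall>X\<in>vector_fields A. \<forall>Y\<in>vector_fields A.
        nabla (scale_field f X) Y = scale_field f (nabla X Y) \<and>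
        nabla X (scale_field f Y) = scale_field (\<lambda>p. X p f) Y + scale_field f (nabla X Y))"

definition cov_deriv02 ::
    "'m connection \<Rightarrow> 'm tensor02 \<Rightarrow> 'm vfield \<Rightarrow> 'm vfield \<Rightarrow> 'm vfield \<Rightarrow> 'm \<Rightarrow> real" where
  "cov_deriv02 nabla T X Y Z =
     (\<lambda>p. X p (app02 T Y Z)) - app02 T (nabla X Y) Z - app02 T Y (nabla X Z)"

definition cov_deriv11 ::
    "'m connection \<Rightarrow> 'm tensor11 \<Rightarrow> 'm vfield \<Rightarrow> 'm vfield \<Rightarrow> 'm vfield" where
  "cov_deriv11 nabla T X Y = nabla X (app11 T Y) - app11 T (nabla X Y)"

text \<open>By the fundamental theorem of pseudo-Riemannian geometry this determines \<open>nabla\<close> on vector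
  fields; its values elsewhere are irrelevant.\<close>

definition levi_civita_connection ::
    "('m::topological_space, 'e::euclidean_space) chart set \<Rightarrow> 'm tensor02 \<Rightarrow> 'm connection \<Rightarrow> bool"
  where
  "levi_civita_connection A g nabla \<longleftrightarrow> affine_connection A nabla \<and>
     (\<forall>X\<in>vector_fields A. \<forall>Y\<in>vector_fields A. nabla X Y - nabla Y X = lie_bracket X Y) \<and>
     (\<forall>X\<in>vector_fields A. \<forall>Y\<in>vector_fields A. \<forall>Z\<in>vector_fields A. cov_deriv02 nabla g X Y Z = 0)"

section \<open>Curvature\<close>

definition curvature :: "'m connection \<Rightarrow> 'm vfield \<Rightarrow> 'm vfield \<Rightarrow> 'm vfield \<Rightarrow> 'm vfield" where
  "curvature nabla X Y Z =
     nabla X (nabla Y Z) - nabla Y (nabla X Z) - nabla (lie_bracket X Y) Z"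

text \<open>The curvature acts on vector fields; since it is tensorial, it acts on tangent vectors at \<open>p\<close>
  by means of arbitrary extensions of these to vector fields on the manifold.\<close>

definition extension ::
    "('m::topological_space, 'e::euclidean_space) chart set \<Rightarrow> 'm \<Rightarrow> 'm tangent \<Rightarrow> 'm vfield" where
  "extension A p v = (SOME X. X \<in> vector_fields A \<and> X p = v)"

definition curvature_at :: "('m::topological_space, 'e::euclidean_space) chart set \<Rightarrow>
    'm connection \<Rightarrow> 'm \<Rightarrow> 'm tangent \<Rightarrow> 'm tangent \<Rightarrow> 'm tangent \<Rightarrow> 'm tangent" where
  "curvature_at A nabla p u v w =
     curvature nabla (extension A p u) (extension A p v) (extension A p w) p"

definition Ric ::
    "('m::topological_space, 'e::euclidean_space) chart set \<Rightarrow> 'm connection \<Rightarrow> 'm tensor02" where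
  "Ric A nabla p v w = trace_on (tangent_space A p) (\<lambda>u. curvature_at A nabla p u v w)"

definition scal :: "('m::topological_space, 'e::euclidean_space) chart set \<Rightarrow>
    'm tensor02 \<Rightarrow> 'm connection \<Rightarrow> 'm \<Rightarrow> real" where
  "scal A g nabla p = metric_trace_on (tangent_space A p) (g p) (Ric A nabla p)"

section \<open>Almost paracontact metric manifolds\<close>

definition paracomplex_structure_on ::
    "('a \<Rightarrow> real) set \<Rightarrow> (('a \<Rightarrow> real) \<Rightarrow> ('a \<Rightarrow> real)) \<Rightarrow> bool" where
  "paracomplex_structure_on D J \<longleftrightarrow>
     linear_on_space D J \<and> (\<forall>v\<in>D. J v \<in> D \<and> J (J v) = v) \<and>
     functional.dim {v\<in>D. J v = v} = functional.dim {v\<in>D. J v = - v}"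

definition almost_paracontact_metric_manifold ::
    "('m::{t2_space, second_countable_topology}, 'e::euclidean_space) chart set \<Rightarrow>
     'm tensor11 \<Rightarrow> 'm tensor01 \<Rightarrow> 'm vfield \<Rightarrow> 'm tensor02 \<Rightarrow> bool" where
  "almost_paracontact_metric_manifold A \<phi> \<eta> \<xi> g \<longleftrightarrow>
     smooth_manifold A \<and> (\<exists>n\<ge>1. DIM('e) = 2 * n + 1) \<and>
     endomorphism_field A \<phi> \<and> one_form A \<eta> \<and> \<xi> \<in> vector_fields A \<and>
     pseudo_riemannian_metric A g \<and>
     (\<forall>p. \<phi> p (\<xi> p) = 0 \<and> \<eta> p (\<xi> p) = 1 \<and>
       (\<forall>v\<in>tangent_space A p. \<eta> p (\<phi> p v) = 0 \<and> \<phi> p (\<phi> p v) = v - scale (\<eta> p v) (\<xi> p)) \<and>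
       paracomplex_structure_on {v\<in>tangent_space A p. \<eta> p v = 0} (\<phi> p) \<and>
       (\<forall>v\<in>tangent_space A p. \<forall>w\<in>tangent_space A p.
          g p (\<phi> p v) (\<phi> p w) = - g p v w + \<eta> p v * \<eta> p w))"

text \<open>In the next two definitions \<open>nabla\<close> is meant to be the Levi-Civita connection of \<open>g\<close>.\<close>

definition quasi_para_sasakian ::
    "('m::{t2_space, second_countable_topology}, 'e::euclidean_space) chart set \<Rightarrow>
     'm tensor11 \<Rightarrow> 'm tensor01 \<Rightarrow> 'm vfield \<Rightarrow> 'm tensor02 \<Rightarrow> 'm connection \<Rightarrow> bool" where
  "quasi_para_sasakian A \<phi> \<eta> \<xi> g nabla \<longleftrightarrow>
     almost_paracontact_metric_manifold A \<phi> \<eta> \<xi> g \<and>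
     (\<forall>X\<in>vector_fields A. \<forall>Y\<in>vector_fields A.
        cov_deriv11 nabla \<phi> X Y = scale_field (app02 g X Y) \<xi> - scale_field (app01 \<eta> Y) X)"

definition eta_parallel_Ricci ::
    "('m::topological_space, 'e::euclidean_space) chart set \<Rightarrow> 'm tensor11 \<Rightarrow> 'm connection \<Rightarrow> bool"
  where
  "eta_parallel_Ricci A \<phi> nabla \<longleftrightarrow>
     (\<forall>X\<in>vector_fields A. \<forall>Y\<in>vector_fields A. \<forall>Z\<in>vector_fields A.
        cov_deriv02 nabla (Ric A nabla) X (app11 \<phi> Y) (app11 \<phi> Z) = 0)"

end

theory Submission
  imports Defs
begin

text \<open>
  The structure equation gives \<open>\<nabla>\<^sub>X \<xi> = \<phi> X\<close>, hence \<open>R(X, Y) \<xi> = \<eta>(X) Y - \<eta>(Y) X\<close>. In a frame \<open>e, f, \<xi>\<close> of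
  eigenvectors of \<open>\<phi>\<close> with \<open>g(e, f) = 1\<close>, the skew symmetries and the first Bianchi identity then leave a
  single free curvature component: \<open>Ric = \<sigma> g - (\<sigma> + 2) \<eta> \<otimes> \<eta>\<close> with \<open>scal = 2 \<sigma> - 2\<close>, and every
  \<open>U \<in> ker \<eta>\<close> satisfies \<open>g(R(U, \<phi>U) U, \<phi>U) = (\<sigma> + 1) g(U, U)\<^sup>2\<close>. Put \<open>U = \<phi> Y\<close> and \<open>N = g(U, U)\<close>. The last
  identity shows that \<open>\<sigma> N\<^sup>3\<close> is smooth, and \<open>\<eta>\<close>-parallelism applied to \<open>N\<^sup>2 Y\<close> and \<open>Y\<close> gives
  \<open>X(\<sigma> N\<^sup>3) = \<sigma> X(N\<^sup>3)\<close>. Since \<open>Y\<close> can be chosen with \<open>N \<noteq> 0\<close> at a given point, the derivative of \<open>\<sigma>\<close> vanishes.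
\<close>

section \<open>Smooth functions on a normed space\<close>

text \<open>The obstacle is that \<open>scal\<close> is only given pointwise, through choices of
  bases and extensions, so nothing says at the outset that \<sigma> can be differentiated. The
  expression g(R(U, \<phi>U) U, \<phi>U) is evaluated on global smooth fields and so gives access to
  \<sigma> through smooth functions, but only multiplied by a power of N. The equation X(\<sigma>
  N^3) = \<sigma> X(N^3) holds because Ric(v, U) = \<sigma> g(v, U) for every v as soon as \<eta>(U)
  = 0: the two correction terms in the covariant derivative of Ric are then \<sigma> times those for
  g, and g is parallel. The factor N^2 in N^2 Y serves to make Ric(\<phi>(N^2 Y), \<phi>Y) the
  function \<sigma> N^3 itself. Tangent vectors are derivations of globally defined smooth
  functions. Germs are therefore replaced by cutoffs: a bump function and Hadamard's lemma yield
  coordinate vectors, extensions of tangent vectors to fields and a tensoriality criterion.\<close>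

lemma Ck_on_cong:
  assumes "open S" "Ck_on k S f" "\<And>x. x \<in> S \<Longrightarrow> f x = g x"
  shows "Ck_on k S g"
  using assms(2,3)
proof (induction k arbitrary: f g)
  case 0
  then show ?case using continuous_on_cong by (metis Ck_on.simps(1))
next
  case (Suc k)
  have *: "(g has_derivative frechet_derivative f (at x)) (at x)" if "x \<in> S" for x
    using Suc.prems that \<open>open S\<close>
    by (metis Ck_on.simps(2) frechet_derivative_works has_derivative_transform_within_open)
  have "Ck_on k S (\<lambda>x. frechet_derivative g (at x) v)" for v
    by (rule Suc.IH[of "\<lambda>x. frechet_derivative f (at x) v"])
      (use Suc.prems(1) frechet_derivative_at[OF *] in simp_all)
  then show ?case using * by (auto simp: differentiable_def)
qed

text \<open>Replaces the abstract \<open>frechet_derivative\<close> by a closed formula; the closure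
  rules below name the derivative explicitly and then apply the induction hypothesis to it.\<close>

lemma Ck_on_SucI:
  assumes "open S" "\<And>x. x \<in> S \<Longrightarrow> (f has_derivative f' x) (at x)" "\<And>v. Ck_on k S (\<lambda>x. f' x v)"
  shows "Ck_on (Suc k) S f"
proof -
  have "Ck_on k S (\<lambda>x. frechet_derivative f (at x) v)" for v
    by (rule Ck_on_cong[OF assms(1) assms(3)[of v]]) (metis assms(2) frechet_derivative_at)
  then show ?thesis using assms(2) by (auto simp: differentiable_def)
qed

lemma Ck_on_has_derivative:
  "Ck_on (Suc k) S f \<Longrightarrow> x \<in> S \<Longrightarrow> (f has_derivative frechet_derivative f (at x)) (at x)"
  by (simp add: frechet_derivative_works)

lemma Ck_on_SucD: "Ck_on (Suc k) S f \<Longrightarrow> Ck_on k S f"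
proof (induction k arbitrary: f)
  case 0
  then show ?case
    by (auto intro!: continuous_at_imp_continuous_on differentiable_imp_continuous_within)
next
  case (Suc k)
  then show ?case by (metis Ck_on.simps(2))
qed

lemma Ck_on_continuous: "Ck_on k S f \<Longrightarrow> continuous_on S f"
  by (induction k) (auto dest: Ck_on_SucD simp del: Ck_on.simps(2))

lemma Ck_on_subset: "Ck_on k S f \<Longrightarrow> T \<subseteq> S \<Longrightarrow> Ck_on k T f"
  by (induction k arbitrary: f) (auto intro: continuous_on_subset)

lemma Ck_on_local:
  assumes "\<And>x. x \<in> S \<Longrightarrow> \<exists>T. open T \<and> x \<in> T \<and> Ck_on k T f"
  shows "Ck_on k S f"
  using assms
proof (induction k arbitrary: f)
  case 0
  show ?case unfolding Ck_on.simps
    by (rule continuous_at_imp_continuous_on) (metis "0" Ck_on.simps(1) continuous_on_eq_continuous_at)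
next
  case (Suc k)
  show ?case unfolding Ck_on.simps
  proof (intro conjI ballI allI)
    show "f differentiable at x" if "x \<in> S" for x using Suc.prems[OF that] by auto
    show "Ck_on k S (\<lambda>x. frechet_derivative f (at x) v)" for v
      by (rule Suc.IH) (use Suc.prems in fastforce)
  qed
qed

lemma Ck_on_const: "open S \<Longrightarrow> Ck_on k S (\<lambda>x. c)"
proof (induction k arbitrary: c)
  case (Suc k)
  then show ?case by (intro Ck_on_SucI[where f' = "\<lambda>x v. 0"]) auto
qed auto

lemma Ck_on_bounded_linear: "open S \<Longrightarrow> bounded_linear L \<Longrightarrow> Ck_on k S L"
proof (cases k)
  case (Suc j)
  assume "open S" "bounded_linear L"
  then show ?thesis unfolding Suc
    by (intro Ck_on_SucI[where f' = "\<lambda>x. L"])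
      (auto intro: bounded_linear.has_derivative[OF _ has_derivative_ident] Ck_on_const)
qed (auto intro: linear_continuous_on)

lemma Ck_on_bounded_linear_compose:
  "open S \<Longrightarrow> bounded_linear L \<Longrightarrow> Ck_on k S f \<Longrightarrow> Ck_on k S (\<lambda>x. L (f x))"
proof (induction k arbitrary: f)
  case 0
  then show ?case by (auto intro: bounded_linear.continuous_on)
next
  case (Suc k)
  show ?case
    by (rule Ck_on_SucI[where f' = "\<lambda>x v. L (frechet_derivative f (at x) v)"])
      (use Suc in \<open>auto intro: bounded_linear.has_derivative Ck_on_has_derivative simp: frechet_derivative_works\<close>)
qed

lemma Ck_on_add: "open S \<Longrightarrow> Ck_on k S f \<Longrightarrow> Ck_on k S g \<Longrightarrow> Ck_on k S (\<lambda>x. f x + g x)"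
proof (induction k arbitrary: f g)
  case 0
  then show ?case by (auto intro: continuous_on_add)
next
  case (Suc k)
  show ?case
    by (rule Ck_on_SucI[where f' = "\<lambda>x v. frechet_derivative f (at x) v + frechet_derivative g (at x) v"])
      (use Suc in \<open>auto intro!: has_derivative_add simp: frechet_derivative_works\<close>)
qed

lemma Ck_on_sum: "open S \<Longrightarrow> (\<And>i. i \<in> I \<Longrightarrow> Ck_on k S (f i)) \<Longrightarrow> Ck_on k S (\<lambda>x. \<Sum>i\<in>I. f i x)"
  by (induction I rule: infinite_finite_induct) (auto intro: Ck_on_const Ck_on_add)

lemma Ck_on_mult:
  fixes f g :: "'a::real_normed_vector \<Rightarrow> real"
  shows "open S \<Longrightarrow> Ck_on k S f \<Longrightarrow> Ck_on k S g \<Longrightarrow> Ck_on k S (\<lambda>x. f x * g x)"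
proof (induction k arbitrary: f g)
  case 0
  then show ?case by (auto intro: continuous_on_mult)
next
  case (Suc k)
  show ?case
  proof (rule Ck_on_SucI[where f' = "\<lambda>x v. f x * frechet_derivative g (at x) v + frechet_derivative f (at x) v * g x"])
    show "open S" by fact
    show "((\<lambda>x. f x * g x) has_derivative
         (\<lambda>v. f x * frechet_derivative g (at x) v + frechet_derivative f (at x) v * g x)) (at x)" if "x \<in> S" for x
      by (intro has_derivative_mult Ck_on_has_derivative[OF Suc.prems(2) that] Ck_on_has_derivative[OF Suc.prems(3) that])
    show "Ck_on k S (\<lambda>x. f x * frechet_derivative g (at x) v + frechet_derivative f (at x) v * g x)" for v
      using Suc.prems Ck_on_SucD[OF Suc.prems(2)] Ck_on_SucD[OF Suc.prems(3)]
      by (intro Ck_on_add Suc.IH) auto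
  qed
qed

lemma Ck_on_compose:
  fixes f :: "'b::euclidean_space \<Rightarrow> real"
  assumes "open S" "open T"
  shows "Ck_on k T f \<Longrightarrow> Ck_on k S u \<Longrightarrow> u ` S \<subseteq> T \<Longrightarrow> Ck_on k S (\<lambda>x. f (u x))"
proof (induction k arbitrary: f)
  case 0
  then show ?case by (auto intro: continuous_on_compose2)
next
  case (Suc k)
  let ?Df = "\<lambda>y. frechet_derivative f (at y)" and ?Du = "\<lambda>x. frechet_derivative u (at x)"
  have Df: "(f has_derivative ?Df (u x)) (at (u x))" and Du: "(u has_derivative ?Du x) (at x)" if "x \<in> S" for x
    using Suc.prems that by (auto simp: frechet_derivative_works)
  \<comment> \<open>In the chain rule x enters both the linear map and its argument. Expansion in
    \<open>Basis\<close> separates them into products of scalar functions; the induction hypothesis,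
    with \<open>f\<close> arbitrary, then treats the partial derivatives of f composed with the same
    u.\<close>
  have eq: "?Df (u x) (?Du x v) = (\<Sum>b\<in>Basis. (?Du x v \<bullet> b) * ?Df (u x) b)" if "x \<in> S" for x v
  proof -
    interpret l: linear "?Df (u x)" using Df[OF that] has_derivative_linear by blast
    have "?Df (u x) (?Du x v) = ?Df (u x) (\<Sum>b\<in>Basis. (?Du x v \<bullet> b) *\<^sub>R b)"
      by (simp add: euclidean_representation)
    also have "\<dots> = (\<Sum>b\<in>Basis. (?Du x v \<bullet> b) * ?Df (u x) b)"
      by (simp add: l.sum l.scale)
    finally show ?thesis .
  qed
  show ?case
  proof (rule Ck_on_SucI[where f' = "\<lambda>x v. ?Df (u x) (?Du x v)"])
    show "open S" by fact
    show "((\<lambda>x. f (u x)) has_derivative (\<lambda>v. ?Df (u x) (?Du x v))) (at x)" if "x \<in> S" for x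
      using diff_chain_at[OF Du[OF that] Df[OF that]] by (simp add: o_def)
    have "Ck_on k S (\<lambda>x. \<Sum>b\<in>Basis. (?Du x v \<bullet> b) * ?Df (u x) b)" for v
      using Suc.prems \<open>open S\<close>
      by (intro Ck_on_sum Ck_on_mult Ck_on_bounded_linear_compose[where L = "\<lambda>x. x \<bullet> _"]
          Suc.IH bounded_linear_inner_left Ck_on_SucD[of k S u]) auto
    then show "Ck_on k S (\<lambda>x. ?Df (u x) (?Du x v))" for v
      by (rule Ck_on_cong[OF \<open>open S\<close>]) (simp add: eq)
  qed
qed

lemma smooth_on_cong: "open S \<Longrightarrow> smooth_on S f \<Longrightarrow> (\<And>x. x \<in> S \<Longrightarrow> f x = g x) \<Longrightarrow> smooth_on S g"
  unfolding smooth_on_def by (metis Ck_on_cong)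

lemma smooth_on_subset: "smooth_on S f \<Longrightarrow> T \<subseteq> S \<Longrightarrow> smooth_on T f"
  unfolding smooth_on_def by (metis Ck_on_subset)

lemma smooth_on_local:
  "(\<And>x. x \<in> S \<Longrightarrow> \<exists>T. open T \<and> x \<in> T \<and> smooth_on T f) \<Longrightarrow> smooth_on S f"
  unfolding smooth_on_def by (meson Ck_on_local)

lemma smooth_on_const: "open S \<Longrightarrow> smooth_on S (\<lambda>x. c)"
  by (simp add: smooth_on_def Ck_on_const)

lemma smooth_on_bounded_linear: "open S \<Longrightarrow> bounded_linear L \<Longrightarrow> smooth_on S L"
  by (simp add: smooth_on_def Ck_on_bounded_linear)

lemma smooth_on_add: "open S \<Longrightarrow> smooth_on S f \<Longrightarrow> smooth_on S g \<Longrightarrow> smooth_on S (\<lambda>x. f x + g x)"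
  by (simp add: smooth_on_def Ck_on_add)

lemma smooth_on_sum:
  "open S \<Longrightarrow> (\<And>i. i \<in> I \<Longrightarrow> smooth_on S (f i)) \<Longrightarrow> smooth_on S (\<lambda>x. \<Sum>i\<in>I. f i x)"
  by (simp add: smooth_on_def Ck_on_sum)

lemma smooth_on_mult:
  fixes f g :: "'a::real_normed_vector \<Rightarrow> real"
  shows "open S \<Longrightarrow> smooth_on S f \<Longrightarrow> smooth_on S g \<Longrightarrow> smooth_on S (\<lambda>x. f x * g x)"
  by (simp add: smooth_on_def Ck_on_mult)

lemma smooth_on_compose:
  fixes f :: "'b::euclidean_space \<Rightarrow> real"
  shows "open S \<Longrightarrow> open T \<Longrightarrow> smooth_on T f \<Longrightarrow> smooth_on S u \<Longrightarrow> u ` S \<subseteq> T \<Longrightarrow>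
    smooth_on S (\<lambda>x. f (u x))"
  by (simp add: smooth_on_def Ck_on_compose)

lemma smooth_on_derivative: "smooth_on S f \<Longrightarrow> smooth_on S (\<lambda>x. frechet_derivative f (at x) v)"
  unfolding smooth_on_def by (metis Ck_on.simps(2))

lemma smooth_on_has_derivative:
  "smooth_on S f \<Longrightarrow> x \<in> S \<Longrightarrow> (f has_derivative frechet_derivative f (at x)) (at x)"
  unfolding smooth_on_def by (meson Ck_on_has_derivative)

lemma smooth_on_continuous: "smooth_on S f \<Longrightarrow> continuous_on S f"
  unfolding smooth_on_def by (meson Ck_on_continuous)

section \<open>A bump function\<close>

text \<open>The powers of \<open>1/t\<close> make the family closed under differentiation.\<close>

definition flat :: "nat \<Rightarrow> real \<Rightarrow> real" where
  "flat n t = (if t \<le> 0 then 0 else inverse t ^ n * exp (- inverse t))"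

text \<open>The substitution x = 1/t turns this into the limit of x^n / exp x at infinity.\<close>

lemma flat_at_right_0: "(flat n \<longlongrightarrow> 0) (at_right 0)"
proof -
  have "((\<lambda>x::real. x ^ n / exp x) \<longlongrightarrow> 0) at_top" by (rule tendsto_power_div_exp_0)
  then have "((\<lambda>t::real. inverse t ^ n / exp (inverse t)) \<longlongrightarrow> 0) (at_right 0)"
    by (rule filterlim_compose[OF _ filterlim_inverse_at_top_right])
  then show ?thesis
    by (rule Lim_transform_eventually)
      (auto simp: flat_def exp_minus divide_inverse eventually_at_right_less intro: eventually_mono[OF eventually_at_right_less])
qed

lemma flat_has_derivative:
  "(flat n has_real_derivative flat (n + 2) t - n * flat (n + 1) t) (at t)"
proof -
  consider "t < 0" | "t = 0" | "t > 0" by linarith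
  then show ?thesis
  proof cases
    case 1
    have "((\<lambda>t. 0) has_real_derivative 0) (at t)" by simp
    then have "(flat n has_real_derivative 0) (at t)"
      by (rule has_field_derivative_transform_within_open[where S = "{..<0}"]) (use 1 in \<open>auto simp: flat_def\<close>)
    then show ?thesis using 1 by (simp add: flat_def)
  next
    case 2
    have l: "((\<lambda>h. (flat n (0 + h) - flat n 0) / h) \<longlongrightarrow> 0) (at_left 0)"
      by (rule Lim_transform_eventually[OF tendsto_const])
        (auto simp: flat_def eventually_at_filter)
    \<comment> \<open>For h > 0 the difference quotient at 0 is \<open>flat (Suc n) h\<close>, so
      the preceding limit applies one index higher.\<close>
    have r: "((\<lambda>h. (flat n (0 + h) - flat n 0) / h) \<longlongrightarrow> 0) (at_right 0)"
      by (rule Lim_transform_eventually[OF flat_at_right_0[of "Suc n"]])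
        (auto simp: flat_def eventually_at_filter divide_inverse)
    show ?thesis using filterlim_split_at[OF l r] unfolding 2 DERIV_def by (simp add: flat_def)
  next
    case 3
    have "((\<lambda>t. inverse t ^ n * exp (- inverse t)) has_real_derivative
        flat (n + 2) t - n * flat (n + 1) t) (at t)"
    proof -
      have "((\<lambda>t. inverse t ^ n * exp (- inverse t)) has_real_derivative
          n * inverse t ^ (n - 1) * (- (inverse t)\<^sup>2) * exp (- inverse t) + inverse t ^ n * (exp (- inverse t) * (inverse t)\<^sup>2)) (at t)"
        using 3 by (auto intro!: derivative_eq_intros simp: power2_eq_square)
      also have "n * inverse t ^ (n - 1) * (- (inverse t)\<^sup>2) * exp (- inverse t) + inverse t ^ n * (exp (- inverse t) * (inverse t)\<^sup>2)
          = flat (n + 2) t - n * flat (n + 1) t"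
        using 3 by (cases n) (simp_all add: flat_def power2_eq_square algebra_simps)
      finally show ?thesis .
    qed
    then show ?thesis
      by (rule has_field_derivative_transform_within_open[where S = "{0<..}"]) (use 3 in \<open>auto simp: flat_def\<close>)
  qed
qed

lemma smooth_on_flat: "smooth_on UNIV (flat n)"
proof -
  have "Ck_on k UNIV (flat n)" for k
  proof (induction k arbitrary: n)
    case 0
    show ?case
      by (auto intro!: continuous_at_imp_continuous_on DERIV_isCont[OF flat_has_derivative])
  next
    case (Suc k)
    show ?case
    proof (rule Ck_on_SucI[where f' = "\<lambda>t v. (flat (n + 2) t + (- real n) * flat (n + 1) t) * v"])
      show "(flat n has_derivative (\<lambda>v. (flat (n + 2) t + (- real n) * flat (n + 1) t) * v)) (at t)" for t
        using flat_has_derivative[of n t] by (simp add: has_field_derivative_def)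
      show "Ck_on k UNIV (\<lambda>t. (flat (n + 2) t + (- real n) * flat (n + 1) t) * v)" for v
        by (intro Ck_on_mult Ck_on_add Ck_on_const Suc.IH) auto
    qed auto
  qed
  then show ?thesis by (simp add: smooth_on_def)
qed

lemma bump_exists:
  fixes a :: "'a::euclidean_space"
  assumes "r > 0"
  obtains \<rho> :: "'a \<Rightarrow> real" where "smooth_on UNIV \<rho>" "\<rho> a = 1" "\<And>x. x \<notin> ball a r \<Longrightarrow> \<rho> x = 0"
proof
  \<comment> \<open>This is r^2 minus the squared distance to a, positive exactly on the ball. It is
    spelled out with sums and products of coordinates so that the closure rules apply; dividing by
    \<open>flat 0\<close> of r^2, its value at a, normalises the bump to 1.\<close>
  let ?u = "\<lambda>x. r\<^sup>2 + (- 1) * (\<Sum>b\<in>Basis. (x \<bullet> b + - (a \<bullet> b)) * (x \<bullet> b + - (a \<bullet> b)))"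
  have u: "?u x = r\<^sup>2 - (dist a x)\<^sup>2" for x
  proof -
    have "(dist a x)\<^sup>2 = (x - a) \<bullet> (x - a)"
      by (simp add: dist_norm norm_minus_commute[of a] power2_norm_eq_inner)
    also have "\<dots> = (\<Sum>b\<in>Basis. ((x - a) \<bullet> b) * ((x - a) \<bullet> b))" by (rule euclidean_inner)
    finally show ?thesis by (simp add: inner_diff_left)
  qed
  let ?\<rho> = "\<lambda>x. inverse (flat 0 (r\<^sup>2)) * flat 0 (?u x)"
  show "smooth_on UNIV ?\<rho>"
    by (intro smooth_on_mult smooth_on_const smooth_on_compose[OF _ _ smooth_on_flat] smooth_on_add
        smooth_on_sum smooth_on_bounded_linear bounded_linear_inner_left) auto
  show "?\<rho> a = 1" using assms by (simp add: flat_def)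
  show "?\<rho> x = 0" if "x \<notin> ball a r" for x
    using that assms unfolding u by (auto simp: flat_def power_mono)
qed

section \<open>Hadamard's lemma\<close>

text \<open>The weight \<open>P\<close> is arbitrary because each differentiation multiplies it by \<open>t\<close>.\<close>

lemma smooth_on_line_integral:
  fixes G :: "'a::euclidean_space \<Rightarrow> real" and P :: "real \<Rightarrow> real"
  assumes "smooth_on UNIV G" "continuous_on UNIV P"
  shows "smooth_on UNIV (\<lambda>x. integral (cbox 0 1) (\<lambda>t. P t * G (a + t *\<^sub>R (x - a))))"
proof -
  have "Ck_on k UNIV (\<lambda>x. integral (cbox 0 1) (\<lambda>t. P t * G (a + t *\<^sub>R (x - a))))" for k
    using assms
  proof (induction k arbitrary: G P)
    case 0
    note * = continuous_on_compose2[OF smooth_on_continuous[OF 0(1)]]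
      continuous_on_compose2[OF 0(2)]
    show ?case unfolding Ck_on.simps
      by (rule integral_continuous_on_param) (auto simp: case_prod_unfold intro!: continuous_intros *)
  next
    case (Suc k)
    let ?D = "\<lambda>y. frechet_derivative G (at y)"
    have D: "(G has_derivative ?D y) (at y)" for y
      using smooth_on_has_derivative[OF Suc.prems(1)] by simp
    have lin: "linear (?D y)" for y using D has_derivative_linear by blast
    note cont = continuous_on_compose2[OF smooth_on_continuous[OF smooth_on_derivative[OF Suc.prems(1)]]]
      continuous_on_compose2[OF smooth_on_continuous[OF Suc.prems(1)]]
      continuous_on_compose2[OF Suc.prems(2)]
    \<comment> \<open>\<open>leibniz_rule\<close> wants the derivative as a bounded linear operator.
      Written in the dual basis, its continuity in (x, t) reduces to that of finitely many scalar
      coefficients.\<close>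
    let ?F = "\<lambda>x t. \<Sum>b\<in>Basis. ((P t * t) * ?D (a + t *\<^sub>R (x - a)) b) *\<^sub>R (blinfun_inner_left b :: 'a \<Rightarrow>\<^sub>L real)"
    have F: "blinfun_apply (?F x t) v = (P t * t) * ?D (a + t *\<^sub>R (x - a)) v" for x t v
    proof -
      have "blinfun_apply (?F x t) v = (P t * t) * (\<Sum>b\<in>Basis. (v \<bullet> b) *\<^sub>R ?D (a + t *\<^sub>R (x - a)) b)"
        by (simp add: blinfun.sum_left blinfun.scaleR_left sum_distrib_left inner_commute ac_simps)
      also have "(\<Sum>b\<in>Basis. (v \<bullet> b) *\<^sub>R ?D (a + t *\<^sub>R (x - a)) b) = ?D (a + t *\<^sub>R (x - a)) v"
        using linear_sum[OF lin] linear_cmul[OF lin]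
        by (metis (no_types, lifting) euclidean_representation sum.cong)
      finally show ?thesis .
    qed
    have Fcont: "continuous_on (UNIV \<times> cbox 0 1) (\<lambda>(x, t). ?F x t)"
      by (auto simp: case_prod_unfold intro!: continuous_intros cont)
    have "((\<lambda>x. integral (cbox 0 1) (\<lambda>t. P t * G (a + t *\<^sub>R (x - a)))) has_derivative
        blinfun_apply (integral (cbox 0 1) (?F x))) (at x within UNIV)" for x
    proof (rule leibniz_rule)
      show "((\<lambda>x. P t * G (a + t *\<^sub>R (x - a))) has_derivative blinfun_apply (?F x t)) (at x within UNIV)"
        for x t
      proof -
        have "((\<lambda>x. a + t *\<^sub>R (x - a)) has_derivative (\<lambda>v. t *\<^sub>R v)) (at x)"
          by (auto intro!: derivative_eq_intros)
        from diff_chain_at[OF this D]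
        have "((\<lambda>x. G (a + t *\<^sub>R (x - a))) has_derivative (\<lambda>v. ?D (a + t *\<^sub>R (x - a)) (t *\<^sub>R v))) (at x)"
          by (simp add: o_def)
        from has_derivative_mult_right[OF this, of "P t"] show ?thesis
          using ext[of "blinfun_apply (?F x t)", OF F] by (simp add: linear_cmul[OF lin] mult.assoc)
      qed
      show "(\<lambda>t. P t * G (a + t *\<^sub>R (x - a))) integrable_on cbox 0 1" for x
        by (intro integrable_continuous continuous_intros cont) auto
    qed (use Fcont in auto)
    \<comment> \<open>Evaluation at v commutes with the integral. What results has the original form
      with a directional derivative of G as integrand, so the induction hypothesis applies.\<close>
    moreover have "blinfun_apply (integral (cbox 0 1) (?F x)) =
      (\<lambda>v. integral (cbox 0 1) (\<lambda>t. (P t * t) * ?D (a + t *\<^sub>R (x - a)) v))" for x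
    proof
      have "?F x integrable_on cbox 0 1"
        by (intro integrable_continuous continuous_intros cont) auto
      then show "blinfun_apply (integral (cbox 0 1) (?F x)) v =
          integral (cbox 0 1) (\<lambda>t. (P t * t) * ?D (a + t *\<^sub>R (x - a)) v)" for v
        by (simp add: blinfun_apply_integral F)
    qed
    ultimately show ?case
      using Suc.prems
      by (intro Ck_on_SucI[where f' = "\<lambda>x v. integral (cbox 0 1) (\<lambda>t. (P t * t) * ?D (a + t *\<^sub>R (x - a)) v)"]
          Suc.IH smooth_on_derivative continuous_intros) auto
  qed
  then show ?thesis by (simp add: smooth_on_def)
qed

text \<open>Integrating the derivative of f along the segment from a to x gives f x - f a; expanding
  the direction x - a in \<open>Basis\<close> pulls its coordinates out of the integral.\<close>

lemma hadamard:
  fixes f :: "'a::euclidean_space \<Rightarrow> real"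
  assumes "smooth_on UNIV f"
  obtains h where "\<And>b. smooth_on UNIV (h b)" "\<And>b. h b a = frechet_derivative f (at a) b"
    "\<And>x. f x = f a + (\<Sum>b\<in>Basis. ((x - a) \<bullet> b) * h b x)"
proof
  let ?D = "\<lambda>y. frechet_derivative f (at y)"
  \<comment> \<open>The factor 1 is the constant weight P that matches
    \<open>smooth_on_line_integral\<close>.\<close>
  let ?h = "\<lambda>b x. integral (cbox 0 1) (\<lambda>t::real. 1 * ?D (a + t *\<^sub>R (x - a)) b)"
  show "smooth_on UNIV (?h b)" for b
    by (intro smooth_on_line_integral smooth_on_derivative assms) auto
  show "?h b a = ?D a b" for b by simp
  have D: "(f has_derivative ?D y) (at y)" for y
    using smooth_on_has_derivative[OF assms] by simp
  have lin: "linear (?D y)" for y using D has_derivative_linear by blast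
  note cont = continuous_on_compose2[OF smooth_on_continuous[OF smooth_on_derivative[OF assms]]]
  show "f x = f a + (\<Sum>b\<in>Basis. ((x - a) \<bullet> b) * ?h b x)" for x
  proof -
    have "((\<lambda>t. ?D (a + t *\<^sub>R (x - a)) (x - a)) has_integral f (a + 1 *\<^sub>R (x - a)) - f (a + 0 *\<^sub>R (x - a))) {0..1::real}"
    proof (rule fundamental_theorem_of_calculus)
      show "((\<lambda>t. f (a + t *\<^sub>R (x - a))) has_vector_derivative ?D (a + t *\<^sub>R (x - a)) (x - a)) (at t within {0..1})" for t
      proof -
        have "((\<lambda>t. a + t *\<^sub>R (x - a)) has_derivative (\<lambda>s. s *\<^sub>R (x - a))) (at t)"
          by (auto intro!: derivative_eq_intros)
        from diff_chain_at[OF this D] show ?thesis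
          by (simp add: o_def has_vector_derivative_def linear_cmul[OF lin] has_derivative_at_withinI)
      qed
    qed simp
    then have "f x - f a = integral (cbox 0 1) (\<lambda>t. ?D (a + t *\<^sub>R (x - a)) (x - a))"
      by (simp add: integral_unique)
    also have "\<dots> = integral (cbox 0 1) (\<lambda>t. \<Sum>b\<in>Basis. ((x - a) \<bullet> b) * ?D (a + t *\<^sub>R (x - a)) b)"
    proof -
      have "?D y v = (\<Sum>b\<in>Basis. (v \<bullet> b) * ?D y b)" for y v
        using linear_sum[OF lin, of y "\<lambda>b. (v \<bullet> b) *\<^sub>R b" Basis] linear_cmul[OF lin, of y]
        by (simp add: euclidean_representation)
      from this[of _ "x - a"] show ?thesis by simp
    qed
    also have "\<dots> = (\<Sum>b\<in>Basis. ((x - a) \<bullet> b) * ?h b x)"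
      by (subst integral_sum) (auto intro!: integrable_continuous_real continuous_intros cont)
    finally show ?thesis by simp
  qed
qed

section \<open>Smooth functions, tangent vectors and vector fields on a manifold\<close>

lemma sum_fun_apply: "(\<Sum>i\<in>I. f i) x = (\<Sum>i\<in>I. f i x :: 'b::comm_monoid_add)"
  by (induction I rule: infinite_finite_induct) auto

section \<open>Charts and the algebra of smooth functions\<close>

locale manifold =
  fixes A :: "('m::{t2_space, second_countable_topology}, 'e::euclidean_space) chart set"
  assumes smooth_manifold: "smooth_manifold A"
begin

abbreviation "sf \<equiv> smooth_functions A"
abbreviation "vf \<equiv> vector_fields A"
abbreviation "TS \<equiv> tangent_space A"

lemma chartD:
  assumes "(U, c) \<in> A"
  shows "open U" "open (c ` U)" "homeomorphism U (c ` U) c (inv_into U c)"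
    "\<And>q. q \<in> U \<Longrightarrow> inv_into U c (c q) = q" "continuous_on U c"
proof -
  have "is_chart (U, c)" using assms smooth_manifold unfolding smooth_manifold_def by blast
  then show *: "open U" "open (c ` U)" "homeomorphism U (c ` U) c (inv_into U c)"
    by (auto simp: is_chart_def)
  show "\<And>q. q \<in> U \<Longrightarrow> inv_into U c (c q) = q" "continuous_on U c"
    using *(3) by (auto simp: homeomorphism_def)
qed

lemma chart_open_image:
  assumes "(U, c) \<in> A" "open W" "W \<subseteq> U"
  shows "open (c ` W)"
proof -
  have "openin (top_of_set U) W" using assms by (simp add: openin_open_eq chartD(1))
  then have "openin (top_of_set (c ` U)) (c ` W)"
    by (rule homeomorphism_imp_open_map[OF chartD(3)[OF assms(1)]])
  then show ?thesis by (simp add: openin_open_eq chartD(2)[OF assms(1)])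
qed

lemma chart_exists: obtains U c where "(U, c) \<in> A" "p \<in> U"
proof -
  have "p \<in> (\<Union>k\<in>A. fst k)" using smooth_manifold by (simp add: smooth_manifold_def)
  then show ?thesis using that by (auto split: prod.splits)
qed

lemma chart_transition:
  assumes "(U, c) \<in> A" "(V, d) \<in> A"
  shows "smooth_on (d ` (V \<inter> U)) (c \<circ> inv_into V d)"
proof -
  have "compatible (V, d) (U, c)" using assms smooth_manifold unfolding smooth_manifold_def by blast
  then show ?thesis by (simp add: compatible_def)
qed

lemma sfD: "f \<in> sf \<Longrightarrow> (U, c) \<in> A \<Longrightarrow> smooth_on (c ` U) (f \<circ> inv_into U c)"
  by (auto simp: smooth_functions_def)

lemma sfI: "(\<And>U c. (U, c) \<in> A \<Longrightarrow> smooth_on (c ` U) (\<lambda>x. f (inv_into U c x))) \<Longrightarrow> f \<in> sf"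
  by (auto simp: smooth_functions_def o_def)

lemma sf_const: "(\<lambda>q. a) \<in> sf"
  by (intro sfI smooth_on_const chartD)

lemma sf_add: "f \<in> sf \<Longrightarrow> h \<in> sf \<Longrightarrow> (\<lambda>q. f q + h q) \<in> sf"
  using sfD by (intro sfI smooth_on_add chartD) (auto simp: o_def)

lemma sf_mult: "f \<in> sf \<Longrightarrow> h \<in> sf \<Longrightarrow> (\<lambda>q. f q * h q) \<in> sf"
  using sfD by (intro sfI smooth_on_mult chartD) (auto simp: o_def)

lemma sf_cmult: "f \<in> sf \<Longrightarrow> (\<lambda>q. a * f q) \<in> sf"
  by (intro sf_mult sf_const)

lemma sf_diff: "f \<in> sf \<Longrightarrow> h \<in> sf \<Longrightarrow> (\<lambda>q. f q - h q) \<in> sf"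
  using sf_add[OF _ sf_cmult[of h "-1"], of f] by simp

lemma sf_sum: "(\<And>i. i \<in> I \<Longrightarrow> f i \<in> sf) \<Longrightarrow> (\<lambda>q. \<Sum>i\<in>I. f i q) \<in> sf"
  by (induction I rule: infinite_finite_induct) (auto intro: sf_const sf_add)

lemmas sf_intros = sf_const sf_add sf_mult sf_diff

text \<open>Two open sets cover the space: W, where the product is smooth, and the complement of the
  closed ball, where the function is 0.\<close>

lemma smooth_cutoff:
  fixes h :: "'a::euclidean_space \<Rightarrow> real"
  assumes "open W" "smooth_on W h" "smooth_on UNIV \<rho>" "cball a r \<subseteq> W" "\<And>x. x \<notin> cball a r \<Longrightarrow> \<rho> x = 0"
  shows "smooth_on UNIV (\<lambda>x. if x \<in> W then \<rho> x * h x else 0)"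
proof (rule smooth_on_local)
  fix x
  show "\<exists>T. open T \<and> x \<in> T \<and> smooth_on T (\<lambda>x. if x \<in> W then \<rho> x * h x else 0)"
  proof (cases "x \<in> W")
    case True
    have "smooth_on W (\<lambda>x. \<rho> x * h x)"
      using assms smooth_on_subset by (intro smooth_on_mult) blast+
    then have "smooth_on W (\<lambda>x. if x \<in> W then \<rho> x * h x else 0)"
      by (rule smooth_on_cong[OF assms(1)]) simp
    with True assms(1) show ?thesis by blast
  next
    case False
    have "smooth_on (- cball a r) (\<lambda>x. if x \<in> W then \<rho> x * h x else 0)"
      by (rule smooth_on_cong[OF _ smooth_on_const[of _ 0]]) (use assms(5) in auto)
    moreover have "x \<in> - cball a r" using False assms(4) by blast
    ultimately show ?thesis by (meson closed_cball open_Compl)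
  qed
qed

text \<open>The same covering argument on the manifold. The support lies in the image of a compact
  ball, which is closed because the space is Hausdorff; this makes the region where the function is
  0 open.\<close>

lemma sf_cutoff:
  assumes U: "(U, c) \<in> A" and h: "smooth_on (c ` U) h" and \<rho>: "smooth_on UNIV \<rho>"
    and r: "cball a r \<subseteq> c ` U" "\<And>x. x \<notin> cball a r \<Longrightarrow> \<rho> x = 0"
  shows "(\<lambda>q. if q \<in> U then \<rho> (c q) * h (c q) else 0) \<in> sf"
proof (rule sfI, rule smooth_on_local)
  fix V d x assume V: "(V, d) \<in> A" and "x \<in> d ` V"
  let ?f = "\<lambda>q. if q \<in> U then \<rho> (c q) * h (c q) else 0"
  let ?g = "\<lambda>x. ?f (inv_into V d x)"
  note Ud = chartD[OF U] and Vd = chartD[OF V]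
  obtain q where q: "q \<in> V" "x = d q" using \<open>x \<in> d ` V\<close> by blast
  show "\<exists>T. open T \<and> x \<in> T \<and> smooth_on T ?g"
  proof (cases "q \<in> U")
    case True
    let ?T = "d ` (V \<inter> U)"
    have o: "open ?T" using V Ud(1) Vd(1) by (intro chart_open_image) auto
    have "smooth_on (c ` U) (\<lambda>x. \<rho> x * h x)"
      using h \<rho> Ud(2) smooth_on_subset by (intro smooth_on_mult) blast+
    then have "smooth_on ?T (\<lambda>x. \<rho> ((c \<circ> inv_into V d) x) * h ((c \<circ> inv_into V d) x))"
      by (rule smooth_on_compose[OF o Ud(2) _ chart_transition[OF U V]]) (auto simp: Vd)
    then have "smooth_on ?T ?g"
      by (rule smooth_on_cong[OF o]) (auto simp: Vd)
    with o q True show ?thesis by blast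
  next
    case False
    let ?K = "inv_into U c ` cball a r"
    have "compact ?K"
      using Ud(3) r(1) by (intro compact_continuous_image) (auto simp: homeomorphism_def intro: continuous_on_subset)
    then have "closed ?K" by (rule compact_imp_closed)
    let ?T = "d ` (V - ?K)"
    have o: "open ?T" using V Vd(1) \<open>closed ?K\<close> by (intro chart_open_image) auto
    have "?K \<subseteq> U" using r(1) by (metis image_mono inv_into_image_cancel subset_refl image_subset_iff inv_into_into subsetD)
    then have "x \<in> ?T" using q False by blast
    moreover have "smooth_on ?T ?g"
    proof (rule smooth_on_cong[OF o smooth_on_const[OF o, of 0]])
      fix y assume "y \<in> ?T"
      then obtain q' where q': "q' \<in> V" "q' \<notin> ?K" "y = d q'" by blast
      have "c q' \<notin> cball a r" if "q' \<in> U" using q'(2) Ud(4)[OF that] by (metis imageI)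
      then show "0 = ?g y" using q' Vd(4) r(2) by auto
    qed
    ultimately show ?thesis using o by blast
  qed
qed

section \<open>Tangent vectors as coordinate derivations\<close>

definition coord_deriv :: "'m set \<Rightarrow> ('m \<Rightarrow> 'e) \<Rightarrow> 'm \<Rightarrow> 'e \<Rightarrow> 'm tangent" where
  "coord_deriv U c q w =
     (\<lambda>f. if f \<in> sf then frechet_derivative (f \<circ> inv_into U c) (at (c q)) w else 0)"

lemma sf_chart_derivative:
  assumes "(U, c) \<in> A" "q \<in> U" "f \<in> sf"
  shows "((f \<circ> inv_into U c) has_derivative (\<lambda>w. coord_deriv U c q w f)) (at (c q))"
  using smooth_on_has_derivative[OF sfD[OF assms(3,1)]] assms by (simp add: coord_deriv_def)

lemma coord_deriv_eqI:
  assumes "(U, c) \<in> A" "q \<in> U" "f \<in> sf" "((f \<circ> inv_into U c) has_derivative D) (at (c q))"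
  shows "coord_deriv U c q w f = D w"
  using has_derivative_unique[OF sf_chart_derivative[OF assms(1-3)] assms(4)] by metis

lemma tangentD:
  assumes "v \<in> TS p"
  shows "f \<in> sf \<Longrightarrow> h \<in> sf \<Longrightarrow> v (\<lambda>q. f q + h q) = v f + v h"
    "f \<in> sf \<Longrightarrow> v (\<lambda>q. a * f q) = a * v f"
    "f \<in> sf \<Longrightarrow> h \<in> sf \<Longrightarrow> v (\<lambda>q. f q * h q) = f p * v h + h p * v f"
    "f \<notin> sf \<Longrightarrow> v f = 0"
  using assms by (auto simp: tangent_space_def plus_fun_def times_fun_def)

lemma tangentI:
  assumes "\<And>f h. f \<in> sf \<Longrightarrow> h \<in> sf \<Longrightarrow> v (\<lambda>q. f q + h q) = v f + v h"
    "\<And>f a. f \<in> sf \<Longrightarrow> v (\<lambda>q. a * f q) = a * v f"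
    "\<And>f h. f \<in> sf \<Longrightarrow> h \<in> sf \<Longrightarrow> v (\<lambda>q. f q * h q) = f p * v h + h p * v f"
    "\<And>f. f \<notin> sf \<Longrightarrow> v f = 0"
  shows "v \<in> TS p"
  using assms by (auto simp: tangent_space_def plus_fun_def times_fun_def)

lemma tangent_const: "v \<in> TS p \<Longrightarrow> v (\<lambda>q. a) = 0"
proof -
  assume v: "v \<in> TS p"
  have "v (\<lambda>q. 1 * 1) = 0" using tangentD(3)[OF v sf_const sf_const, of 1 1] by simp
  then show ?thesis using tangentD(2)[OF v sf_const, of a 1] by simp
qed

lemma tangent_sum:
  assumes "v \<in> TS p" "\<And>i. i \<in> I \<Longrightarrow> f i \<in> sf"
  shows "v (\<lambda>q. \<Sum>i\<in>I. f i q) = (\<Sum>i\<in>I. v (f i))"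
  using assms(2)
  by (induction I rule: infinite_finite_induct)
    (auto simp: tangent_const[OF assms(1)] tangentD(1)[OF assms(1)] sf_sum)

lemma tangent_diff:
  "v \<in> TS p \<Longrightarrow> f \<in> sf \<Longrightarrow> h \<in> sf \<Longrightarrow> v (\<lambda>q. f q - h q) = v f - v h"
  using tangentD(1)[of v p f "\<lambda>q. -1 * h q"] tangentD(2)[of v p h "-1"] sf_cmult[of h "-1"] by simp

lemma tangent_subspace: "functional.subspace (TS p)"
  unfolding functional.subspace_def
proof (intro conjI ballI allI)
  show "0 \<in> TS p" by (rule tangentI) simp_all
  fix v assume v: "v \<in> TS p"
  show "scale a v \<in> TS p" for a
    by (rule tangentI) (simp_all add: scale_def tangentD[OF v] algebra_simps)
  fix w assume w: "w \<in> TS p"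
  show "v + w \<in> TS p"
    by (rule tangentI) (simp_all add: tangentD[OF v] tangentD[OF w] algebra_simps)
qed

lemmas tangent_0 = functional.subspace_0[OF tangent_subspace]
lemmas tangent_add = functional.subspace_add[OF tangent_subspace]
lemmas tangent_scale = functional.subspace_scale[OF tangent_subspace]
lemmas tangent_minus = functional.subspace_diff[OF tangent_subspace]

lemma coord_deriv_tangent:
  assumes "(U, c) \<in> A" "q \<in> U"
  shows "coord_deriv U c q w \<in> TS q"
proof (rule tangentI)
  note D = sf_chart_derivative[OF assms]
  note E = coord_deriv_eqI[OF assms]
  show "coord_deriv U c q w f = 0" if "f \<notin> sf" for f using that by (simp add: coord_deriv_def)
  fix f assume f: "f \<in> sf"
  show "coord_deriv U c q w (\<lambda>q. a * f q) = a * coord_deriv U c q w f" for a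
    using has_derivative_mult_right[OF D[OF f], of a] by (intro E sf_cmult f) (simp add: o_def)
  fix h assume h: "h \<in> sf"
  show "coord_deriv U c q w (\<lambda>q. f q + h q) = coord_deriv U c q w f + coord_deriv U c q w h"
    using has_derivative_add[OF D[OF f] D[OF h]] by (intro E sf_add f h) (simp add: o_def)
  show "coord_deriv U c q w (\<lambda>q. f q * h q) = f q * coord_deriv U c q w h + h q * coord_deriv U c q w f"
    using has_derivative_mult[OF D[OF f] D[OF h]] chartD(4)[OF assms]
    by (intro E sf_mult f h) (simp add: o_def mult.commute[of _ "h q"])
qed

lemma coord_deriv_linear:
  assumes "(U, c) \<in> A" "q \<in> U"
  shows "coord_deriv U c q (\<Sum>i\<in>I. a i *\<^sub>R w i) = (\<Sum>i\<in>I. scale (a i) (coord_deriv U c q (w i)))"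
proof
  fix f
  have *: "(\<Sum>i\<in>I. scale (a i) (coord_deriv U c q (w i))) f = (\<Sum>i\<in>I. a i * coord_deriv U c q (w i) f)"
    by (simp add: sum_fun_apply scale_def)
  show "coord_deriv U c q (\<Sum>i\<in>I. a i *\<^sub>R w i) f = (\<Sum>i\<in>I. scale (a i) (coord_deriv U c q (w i))) f"
  proof (cases "f \<in> sf")
    case True
    from has_derivative_linear[OF sf_chart_derivative[OF assms True]]
    interpret l: linear "\<lambda>w. coord_deriv U c q w f" .
    show ?thesis unfolding * by (simp add: l.sum l.scale)
  next
    case False then show ?thesis unfolding * by (simp add: coord_deriv_def)
  qed
qed

text \<open>The closed ball inside the chart image gives compact support, which is what extension by
  0 to the whole manifold relies on.\<close>

definition cutoff :: "'m set \<Rightarrow> ('m \<Rightarrow> 'e) \<Rightarrow> 'm \<Rightarrow> ('e \<Rightarrow> real) \<Rightarrow> bool" where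
  "cutoff U c p \<rho> \<longleftrightarrow> (U, c) \<in> A \<and> p \<in> U \<and> smooth_on UNIV \<rho> \<and> \<rho> (c p) = 1 \<and>
     (\<exists>r. cball (c p) r \<subseteq> c ` U \<and> (\<forall>x. x \<notin> cball (c p) r \<longrightarrow> \<rho> x = 0))"

lemma cutoff_exists:
  assumes "(U, c) \<in> A" "p \<in> U"
  obtains \<rho> where "cutoff U c p \<rho>"
proof -
  obtain r where r: "r > 0" "cball (c p) r \<subseteq> c ` U"
    using chartD(2)[OF assms(1)] assms(2) by (meson imageI open_contains_cball)
  obtain \<rho> :: "'e \<Rightarrow> real" where "smooth_on UNIV \<rho>" "\<rho> (c p) = 1" "\<And>x. x \<notin> ball (c p) r \<Longrightarrow> \<rho> x = 0"
    using bump_exists[OF r(1), of "c p"] by blast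
  then have "cutoff U c p \<rho>" unfolding cutoff_def using assms r by (metis ball_subset_cball subsetD)
  then show ?thesis ..
qed

text \<open>Taking h = 1 gives a global copy P of the cutoff; taking a coordinate function gives P
  x^b, the global substitute for that coordinate.\<close>

definition extend :: "'m set \<Rightarrow> ('m \<Rightarrow> 'e) \<Rightarrow> ('e \<Rightarrow> real) \<Rightarrow> ('e \<Rightarrow> real) \<Rightarrow> 'm \<Rightarrow> real" where
  "extend U c \<rho> h = (\<lambda>q. if q \<in> U then \<rho> (c q) * h (c q) else 0)"

lemma extend_sf: "cutoff U c p \<rho> \<Longrightarrow> smooth_on (c ` U) h \<Longrightarrow> extend U c \<rho> h \<in> sf"
  unfolding cutoff_def extend_def by (auto intro: sf_cutoff)

lemma coord_deriv_extend:
  assumes "cutoff U c p \<rho>" "q \<in> U" "smooth_on (c ` U) h"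
  shows "coord_deriv U c q w (extend U c \<rho> h) =
    \<rho> (c q) * frechet_derivative h (at (c q)) w + frechet_derivative \<rho> (at (c q)) w * h (c q)"
proof -
  have U: "(U, c) \<in> A" and \<rho>: "smooth_on UNIV \<rho>" using assms(1) by (auto simp: cutoff_def)
  show ?thesis
  proof (rule coord_deriv_eqI[OF U assms(2) extend_sf[OF assms(1,3)]])
    have "((\<lambda>x. \<rho> x * h x) has_derivative (\<lambda>w. \<rho> (c q) * frechet_derivative h (at (c q)) w
        + frechet_derivative \<rho> (at (c q)) w * h (c q))) (at (c q))"
      by (intro has_derivative_mult smooth_on_has_derivative[OF \<rho>] smooth_on_has_derivative[OF assms(3)])
        (use assms(2) in auto)
    then show "((extend U c \<rho> h \<circ> inv_into U c) has_derivative (\<lambda>w. \<rho> (c q) * frechet_derivative h (at (c q)) w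
        + frechet_derivative \<rho> (at (c q)) w * h (c q))) (at (c q))"
      by (rule has_derivative_transform_within_open[OF _ chartD(2)[OF U]])
        (use assms(2) chartD(4)[OF U] in \<open>auto simp: extend_def\<close>)
  qed
qed

lemma frechet_derivative_coord:
  "frechet_derivative (\<lambda>x. (x - a) \<bullet> b) (at x) w = (w \<bullet> b :: real)"
  by (rule sym, rule fun_cong[OF frechet_derivative_at]) (auto intro!: derivative_eq_intros)

lemma smooth_on_coord: "open S \<Longrightarrow> smooth_on S (\<lambda>x. (x - a) \<bullet> b)"
  using smooth_on_add[OF _ smooth_on_bounded_linear[OF _ bounded_linear_inner_left] smooth_on_const, of S b "- (a \<bullet> b)"]
  by (simp add: inner_diff_left)

text \<open>Let \<open>P\<close> be a cutoff with \<open>P p = 1\<close>. Comparing \<open>v f\<close> with \<open>v (P\<^sup>3 f)\<close> by the Leibniz rule replaces the usual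
  locality argument, so \<open>P\<close> need not be 1 near \<open>p\<close>; the error term \<open>f p * K\<close> is removed by taking \<open>f = 1\<close>.\<close>

lemma tangent_eq_coord_deriv:
  assumes U: "(U, c) \<in> A" "p \<in> U" and v: "v \<in> TS p"
  obtains w where "v = coord_deriv U c p w"
proof -
  obtain \<rho> where \<rho>: "cutoff U c p \<rho>" using cutoff_exists[OF U] .
  then obtain r where \<rho>': "smooth_on UNIV \<rho>" "\<rho> (c p) = 1"
    and r: "cball (c p) r \<subseteq> c ` U" "\<And>x. x \<notin> cball (c p) r \<Longrightarrow> \<rho> x = 0"
    by (auto simp: cutoff_def)
  note Ud = chartD[OF U(1)]
  let ?P = "extend U c \<rho> (\<lambda>x. 1)" and ?X = "\<lambda>b. extend U c \<rho> (\<lambda>x. (x - c p) \<bullet> b)"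
  \<comment> \<open>The components of w are the values of v on the localised coordinates P
    x^b.\<close>
  let ?w = "\<Sum>b\<in>Basis. v (?X b) *\<^sub>R b"
  have P: "?P \<in> sf" and X: "?X b \<in> sf" for b
    using Ud(2) by (auto intro!: extend_sf[OF \<rho>] smooth_on_const smooth_on_coord)
  have key: "v f = f p * K + coord_deriv U c p ?w f"
    if f: "f \<in> sf" and K: "K = (\<Sum>b\<in>Basis. v (?X b) * frechet_derivative \<rho> (at (c p)) b) - v ?P" for f K
  proof -
    define k where "k = (\<lambda>x. if x \<in> c ` U then \<rho> x * (f \<circ> inv_into U c) x else 0)"
    have ks: "smooth_on UNIV k"
      unfolding k_def by (rule smooth_cutoff[OF Ud(2) sfD[OF f U(1)] \<rho>'(1) r])
    obtain h where h: "\<And>b. smooth_on UNIV (h b)" "\<And>b. h b (c p) = frechet_derivative k (at (c p)) b"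
      "\<And>x. k x = k (c p) + (\<Sum>b\<in>Basis. ((x - c p) \<bullet> b) * h b x)"
      by (rule hadamard[OF ks, where a = "c p"]) (rule that; assumption)
    have kf: "k (c q) = \<rho> (c q) * f q" if "q \<in> U" for q using that Ud(4) by (auto simp: k_def)
    have dk: "frechet_derivative k (at (c p)) b = coord_deriv U c p b f + frechet_derivative \<rho> (at (c p)) b * f p" for b
    proof -
      have "((\<lambda>x. \<rho> x * (f \<circ> inv_into U c) x) has_derivative (\<lambda>w. \<rho> (c p) * coord_deriv U c p w f
        + frechet_derivative \<rho> (at (c p)) w * (f \<circ> inv_into U c) (c p))) (at (c p))"
        by (intro has_derivative_mult smooth_on_has_derivative[OF \<rho>'(1)] sf_chart_derivative U f) auto
      then have "(k has_derivative (\<lambda>w. \<rho> (c p) * coord_deriv U c p w f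
        + frechet_derivative \<rho> (at (c p)) w * (f \<circ> inv_into U c) (c p))) (at (c p))"
        by (rule has_derivative_transform_within_open[OF _ Ud(2)]) (use U in \<open>auto simp: k_def\<close>)
      from fun_cong[OF frechet_derivative_at[OF this], of b]
      show ?thesis unfolding \<rho>'(2) comp_apply Ud(4)[OF U(2)] by linarith
    qed
    let ?H = "\<lambda>b. extend U c \<rho> (h b)"
    have H: "?H b \<in> sf" for b by (rule extend_sf[OF \<rho> smooth_on_subset[OF h(1)]]) simp
    have Pp: "?P p = 1" and Xp: "?X b p = 0" and Hp: "?H b p = h b (c p)" for b
      using U(2) \<rho>'(2) by (auto simp: extend_def)
    \<comment> \<open>Hadamard's expansion of \<rho> f at c p, multiplied by \<rho>^2: one factor
      \<rho> globalises each coordinate and the other each h b. The constant term is f p because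
      \<rho> is 1 at c p.\<close>
    have eq: "(\<lambda>q. (?P q * ?P q) * (?P q * f q)) = (\<lambda>q. f p * (?P q * ?P q) + (\<Sum>b\<in>Basis. ?X b q * ?H b q))"
    proof
      fix q
      show "(?P q * ?P q) * (?P q * f q) = f p * (?P q * ?P q) + (\<Sum>b\<in>Basis. ?X b q * ?H b q)"
      proof (cases "q \<in> U")
        case True
        have "\<rho> (c q) * f q = f p + (\<Sum>b\<in>Basis. ((c q - c p) \<bullet> b) * h b (c q))"
          using h(3)[of "c q"] kf[OF True] kf[OF U(2)] \<rho>'(2) by simp
        then have "\<rho> (c q) * \<rho> (c q) * (\<rho> (c q) * f q) =
            f p * (\<rho> (c q) * \<rho> (c q)) + (\<Sum>b\<in>Basis. \<rho> (c q) * \<rho> (c q) * (((c q - c p) \<bullet> b) * h b (c q)))"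
          by (simp add: distrib_left sum_distrib_left mult.commute)
        then show ?thesis using True by (simp add: extend_def mult.assoc mult.left_commute)
      qed (simp add: extend_def)
    qed
    have "v (\<lambda>q. (?P q * ?P q) * (?P q * f q)) = 3 * f p * v ?P + v f"
      by (simp add: tangentD[OF v] P f sf_intros Pp)
    moreover have "v (\<lambda>q. f p * (?P q * ?P q) + (\<Sum>b\<in>Basis. ?X b q * ?H b q)) =
        f p * (2 * v ?P) + (\<Sum>b\<in>Basis. h b (c p) * v (?X b))"
      by (simp add: tangentD[OF v] tangent_sum[OF v] P X H sf_intros sf_sum Pp Xp Hp)
    moreover have "coord_deriv U c p ?w f = (\<Sum>b\<in>Basis. v (?X b) * coord_deriv U c p b f)"
    proof -
      have "coord_deriv U c p ?w f = (\<Sum>b\<in>Basis. scale (v (?X b)) (coord_deriv U c p b)) f"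
        by (simp add: coord_deriv_linear[OF U])
      also have "\<dots> = (\<Sum>b\<in>Basis. v (?X b) * coord_deriv U c p b f)"
        by (simp add: sum_fun_apply scale_def)
      finally show ?thesis .
    qed
    moreover have "(\<Sum>b\<in>Basis. h b (c p) * v (?X b)) = (\<Sum>b\<in>Basis. v (?X b) * coord_deriv U c p b f)
        + f p * (\<Sum>b\<in>Basis. v (?X b) * frechet_derivative \<rho> (at (c p)) b)"
      unfolding h(2) dk by (simp add: distrib_left sum.distrib sum_distrib_left ac_simps)
    moreover have "f p * K = f p * (\<Sum>b\<in>Basis. v (?X b) * frechet_derivative \<rho> (at (c p)) b) - f p * v ?P"
      by (simp add: K right_diff_distrib)
    ultimately show ?thesis
      using arg_cong[OF eq, of v] by linarith
  qed
  define K where "K = (\<Sum>b\<in>Basis. v (?X b) * frechet_derivative \<rho> (at (c p)) b) - v ?P"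
  have "K = 0"
    using key[OF sf_const[of 1] K_def] tangent_const[OF v] tangent_const[OF coord_deriv_tangent[OF U]] by simp
  have "v f = coord_deriv U c p ?w f" for f
    using key[OF _ K_def, of f] \<open>K = 0\<close> tangentD(4)[OF v] by (cases "f \<in> sf") (auto simp: coord_deriv_def)
  then show ?thesis using that by blast
qed

text \<open>The localised coordinates recover the components of w: the term containing the
  derivative of \<rho> carries the factor x^b, which vanishes at c p.\<close>

lemma coord_deriv_inj:
  assumes U: "(U, c) \<in> A" "p \<in> U" and "coord_deriv U c p w = 0"
  shows "w = 0"
proof -
  obtain \<rho> where \<rho>: "cutoff U c p \<rho>" using cutoff_exists[OF U] .
  have "coord_deriv U c p w (extend U c \<rho> (\<lambda>x. (x - c p) \<bullet> b)) = w \<bullet> b" for b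
    using coord_deriv_extend[OF \<rho> U(2) smooth_on_coord[OF chartD(2)[OF U(1)]]] \<rho>
    by (simp add: frechet_derivative_coord cutoff_def)
  then show ?thesis using assms(3) by (metis inner_eq_zero_iff zero_fun_apply)
qed

section \<open>Vector fields, extension of tangent vectors and tensoriality\<close>

definition coord_field :: "'m set \<Rightarrow> ('m \<Rightarrow> 'e) \<Rightarrow> ('e \<Rightarrow> real) \<Rightarrow> 'e \<Rightarrow> 'm vfield" where
  "coord_field U c \<rho> w = (\<lambda>q. if q \<in> U then scale (\<rho> (c q)) (coord_deriv U c q w) else 0)"

text \<open>Applied to a smooth function, the field yields \<open>extend\<close> of a partial
  derivative, so smoothness is that of \<open>extend_sf\<close>.\<close>

lemma coord_field_vf:
  assumes "cutoff U c p \<rho>"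
  shows "coord_field U c \<rho> w \<in> vf"
proof -
  have U: "(U, c) \<in> A" using assms by (simp add: cutoff_def)
  have "(\<lambda>q. coord_field U c \<rho> w q f) \<in> sf" if f: "f \<in> sf" for f
  proof -
    have "(\<lambda>q. coord_field U c \<rho> w q f) = extend U c \<rho> (\<lambda>x. frechet_derivative (f \<circ> inv_into U c) (at x) w)"
      using f by (auto simp: coord_field_def extend_def coord_deriv_def scale_def)
    then show ?thesis using extend_sf[OF assms smooth_on_derivative[OF sfD[OF f U]]] by simp
  qed
  moreover have "coord_field U c \<rho> w q \<in> TS q" for q
    by (auto simp: coord_field_def intro: tangent_0 tangent_scale coord_deriv_tangent[OF U])
  ultimately show ?thesis by (simp add: vector_fields_def)
qed

lemma vfD: "X \<in> vf \<Longrightarrow> X p \<in> TS p" "X \<in> vf \<Longrightarrow> f \<in> sf \<Longrightarrow> (\<lambda>p. X p f) \<in> sf"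
  by (auto simp: vector_fields_def)

text \<open>The choice in \<open>extension\<close> has a witness: a field with constant coefficients
  in a chart, multiplied by a cutoff.\<close>

lemma vf_extension:
  assumes "v \<in> TS p"
  shows "extension A p v \<in> vf" "extension A p v p = v"
proof -
  obtain U c where U: "(U, c) \<in> A" "p \<in> U" by (rule chart_exists)
  obtain \<rho> where \<rho>: "cutoff U c p \<rho>" using cutoff_exists[OF U] .
  obtain w where w: "v = coord_deriv U c p w" using tangent_eq_coord_deriv[OF U assms] .
  have "coord_field U c \<rho> w p = v" using U \<rho> w by (auto simp: coord_field_def cutoff_def scale_def)
  then have "\<exists>X. X \<in> vf \<and> X p = v" using coord_field_vf[OF \<rho>] by blast
  from someI_ex[OF this] show "extension A p v \<in> vf" "extension A p v p = v"
    by (auto simp: extension_def)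
qed

lemma vf_0: "0 \<in> vf" by (auto simp: vector_fields_def tangent_0 sf_const)

lemma vf_add: "X \<in> vf \<Longrightarrow> Y \<in> vf \<Longrightarrow> X + Y \<in> vf"
  by (auto simp: vector_fields_def tangent_add sf_add)

lemma vf_diff: "X \<in> vf \<Longrightarrow> Y \<in> vf \<Longrightarrow> X - Y \<in> vf"
  by (auto simp: vector_fields_def tangent_minus sf_diff)

lemma vf_scale: "f \<in> sf \<Longrightarrow> X \<in> vf \<Longrightarrow> scale_field f X \<in> vf"
  by (auto simp: vector_fields_def scale_field_def tangent_scale) (auto simp: scale_def sf_mult)

lemma vf_sum: "(\<And>i. i \<in> I \<Longrightarrow> X i \<in> vf) \<Longrightarrow> (\<Sum>i\<in>I. X i) \<in> vf"
  by (induction I rule: infinite_finite_induct) (auto intro: vf_0 vf_add)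

lemma vf_lie_bracket:
  assumes X: "X \<in> vf" and Y: "Y \<in> vf"
  shows "lie_bracket X Y \<in> vf"
proof -
  \<comment> \<open>For a non-smooth f the inner function is constantly 0 by the default value, and
    a derivation kills constants. This gives the bracket the required default.\<close>
  have nz: "X p (\<lambda>q. Y q f) = 0 \<and> Y p (\<lambda>q. X q f) = 0" if "f \<notin> sf" for p f
    using tangentD(4)[OF vfD(1)[OF X] that] tangentD(4)[OF vfD(1)[OF Y] that]
    by (simp add: tangent_const[OF vfD(1)[OF X]] tangent_const[OF vfD(1)[OF Y]])
  have "lie_bracket X Y p \<in> TS p" for p
    by (rule tangentI)
      (simp_all add: lie_bracket_def tangentD(1-3)[OF vfD(1)[OF X]] tangentD(1-3)[OF vfD(1)[OF Y]]
        vfD(2)[OF X] vfD(2)[OF Y] sf_add sf_cmult sf_mult nz, simp_all add: algebra_simps)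
  then show ?thesis
    by (auto simp: vector_fields_def) (auto simp: lie_bracket_def intro!: sf_diff vfD(2)[OF X] vfD(2)[OF Y])
qed

text \<open>With \<open>P\<close> as above, \<open>P\<^sup>3 Y\<close> is a combination of global fields whose coefficients are smooth and vanish
  at \<open>p\<close>: in coordinates \<open>P\<^sup>2 Y\<^sup>b = P Y(P x\<^sup>b) - P x\<^sup>b Y(P)\<close>.\<close>

lemma tensorial_zero:
  fixes F :: "'m vfield \<Rightarrow> real"
  assumes add: "\<And>X Y. X \<in> vf \<Longrightarrow> Y \<in> vf \<Longrightarrow> F (X + Y) = F X + F Y"
    and scale: "\<And>f X. f \<in> sf \<Longrightarrow> X \<in> vf \<Longrightarrow> F (scale_field f X) = f p * F X"
    and Y: "Y \<in> vf" "Y p = 0"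
  shows "F Y = 0"
proof -
  obtain U c where U: "(U, c) \<in> A" "p \<in> U" by (rule chart_exists)
  obtain \<rho> where \<rho>: "cutoff U c p \<rho>" using cutoff_exists[OF U] .
  then have \<rho>': "\<rho> (c p) = 1" by (simp add: cutoff_def)
  note o = chartD(2)[OF U(1)]
  let ?P = "extend U c \<rho> (\<lambda>x. 1)" and ?X = "\<lambda>b. extend U c \<rho> (\<lambda>x. (x - c p) \<bullet> b)"
  have P: "?P \<in> sf" and X: "?X b \<in> sf" for b
    using o by (auto intro!: extend_sf[OF \<rho>] smooth_on_const smooth_on_coord)
  define k where "k b = (\<lambda>q. ?P q * Y q (?X b) - ?X b q * Y q ?P)" for b
  let ?S = "\<Sum>b\<in>Basis. scale_field (k b) (coord_field U c \<rho> b)"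
  have k: "k b \<in> sf" for b unfolding k_def by (intro sf_intros vfD(2)[OF Y(1)] P X)
  have "scale_field (\<lambda>q. ?P q * (?P q * ?P q)) Y = ?S"
  proof
    fix q
    have S: "?S q = (\<Sum>b\<in>Basis. scale (k b q) (coord_field U c \<rho> b q))"
      by (simp add: sum_fun_apply scale_field_def)
    show "scale_field (\<lambda>q. ?P q * (?P q * ?P q)) Y q = ?S q"
    proof (cases "q \<in> U")
      case True
      obtain w where w: "Y q = coord_deriv U c q w"
        using tangent_eq_coord_deriv[OF U(1) True vfD(1)[OF Y(1)]] .
      have "k b q = \<rho> (c q) * \<rho> (c q) * (w \<bullet> b)" for b
        unfolding k_def w
        by (simp add: coord_deriv_extend[OF \<rho> True] smooth_on_coord smooth_on_const o frechet_derivative_coord)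
          (simp add: extend_def True algebra_simps)
      then have "?S q = (\<Sum>b\<in>Basis. scale (\<rho> (c q) * (\<rho> (c q) * \<rho> (c q))) (scale (w \<bullet> b) (coord_deriv U c q b)))"
        unfolding S using True by (intro sum.cong) (auto simp: coord_field_def scale_def fun_eq_iff)
      also have "\<dots> = scale (\<rho> (c q) * (\<rho> (c q) * \<rho> (c q))) (coord_deriv U c q w)"
        using coord_deriv_linear[OF U(1) True, of "\<lambda>b. w \<bullet> b" "\<lambda>b. b" Basis]
        by (simp add: functional.scale_sum_right euclidean_representation)
      finally show ?thesis using True by (simp add: scale_field_def extend_def w)
    next
      case False
      then show ?thesis unfolding S
        by (simp add: scale_field_def extend_def coord_field_def functional.scale_zero_left functional.scale_zero_right)
    qed
  qed
  moreover have "F (scale_field (\<lambda>q. ?P q * (?P q * ?P q)) Y) = F Y"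
    using \<rho>' U(2) by (subst scale[OF sf_mult[OF P sf_mult[OF P P]] Y(1)]) (simp add: extend_def)
  moreover have "F ?S = 0"
  proof -
    have kp: "k b p = 0" for b by (simp add: k_def Y(2))
    have "F 0 = 0" using add[OF vf_0 vf_0] by simp
    have "F (\<Sum>b\<in>I. scale_field (k b) (coord_field U c \<rho> b)) = 0" if "finite I" for I
      using that
    proof (induction I rule: finite_induct)
      case (insert b I)
      have "F (scale_field (k b) (coord_field U c \<rho> b) + (\<Sum>b\<in>I. scale_field (k b) (coord_field U c \<rho> b))) = 0"
        by (subst add)
          (simp_all add: insert scale k kp coord_field_vf[OF \<rho>] vf_scale vf_sum del: sum_fun_apply plus_fun_apply)
      then show ?case by (simp only: sum.insert[OF insert(1,2)])
    qed (simp only: sum.empty \<open>F 0 = 0\<close>)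
    from this[OF finite_Basis] show ?thesis .
  qed
  ultimately show ?thesis by simp
qed

text \<open>This makes values of the curvature at a point independent of the fields that extend its
  arguments.\<close>

lemma tensorial_eq:
  fixes F :: "'m vfield \<Rightarrow> real"
  assumes add: "\<And>X Y. X \<in> vf \<Longrightarrow> Y \<in> vf \<Longrightarrow> F (X + Y) = F X + F Y"
    and scale: "\<And>f X. f \<in> sf \<Longrightarrow> X \<in> vf \<Longrightarrow> F (scale_field f X) = f p * F X"
    and XY: "X \<in> vf" "Y \<in> vf" "X p = Y p"
  shows "F X = F Y"
proof -
  have "F (X - Y) = 0" using XY by (intro tensorial_zero[of F p] add scale vf_diff) auto
  moreover have "F (X - Y + Y) = F (X - Y) + F Y" by (intro add vf_diff XY)
  ultimately show ?thesis by simp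
qed

lemma tangent_basis:
  obtains B where "functional.independent B" "functional.span B = TS p" "finite B" "card B = DIM('e)"
proof -
  obtain U c where U: "(U, c) \<in> A" "p \<in> U" by (rule chart_exists)
  let ?d = "coord_deriv U c p"
  let ?B = "?d ` Basis"
  have inj: "inj_on ?d Basis"
  proof (rule inj_onI)
    fix a b :: 'e assume "a \<in> Basis" "b \<in> Basis" "?d a = ?d b"
    \<comment> \<open>The difference is a sum indexed by \<open>bool\<close> with coefficients 1 and
      -1, which brings it under the linearity rule for sums.\<close>
    have "?d (a - b) = 0"
      using coord_deriv_linear[OF U, of "\<lambda>i. if i then 1 else -1" "\<lambda>i. if i then a else b" UNIV] \<open>?d a = ?d b\<close>
      by (simp add: UNIV_bool scale_def fun_eq_iff)
    then show "a = b" using coord_deriv_inj[OF U] by fastforce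
  qed
  have ind: "\<forall>v\<in>T. u v = 0" if T: "finite T" "T \<subseteq> ?B" and s: "(\<Sum>v\<in>T. scale (u v) v) = 0" for T u
  proof -
    obtain I where I: "I \<subseteq> Basis" "T = ?d ` I" using T(2) by (meson subset_imageE)
    have "0 = (\<Sum>b\<in>I. scale (u (?d b)) (?d b))"
      using s unfolding I(2) sum.reindex[OF inj_on_subset[OF inj I(1)]] by simp
    then have "?d (\<Sum>b\<in>I. u (?d b) *\<^sub>R b) = 0" by (simp add: coord_deriv_linear[OF U])
    then have z: "(\<Sum>b\<in>I. u (?d b) *\<^sub>R b) = 0" by (rule coord_deriv_inj[OF U])
    have "finite I" using I(1) finite_subset finite_Basis by blast
    then have "u (?d b) = 0" if "b \<in> I" for b
      by (rule independentD[OF independent_Basis _ I(1) z that])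
    then show ?thesis unfolding I(2) by blast
  qed
  have "functional.independent ?B"
    unfolding functional.independent_explicit_module by (intro allI impI) (drule (2) ind, simp)
  moreover have "functional.span ?B = TS p"
  proof
    show "functional.span ?B \<subseteq> TS p"
      by (rule functional.span_minimal) (auto intro: coord_deriv_tangent[OF U] tangent_subspace)
    show "TS p \<subseteq> functional.span ?B"
    proof
      fix v assume "v \<in> TS p"
      then obtain w where "v = ?d w" using tangent_eq_coord_deriv[OF U] by blast
      then have "v = (\<Sum>b\<in>Basis. scale (w \<bullet> b) (?d b))"
        using coord_deriv_linear[OF U, of "\<lambda>b. w \<bullet> b" "\<lambda>b. b" Basis] by (simp add: euclidean_representation)
      then show "v \<in> functional.span ?B"
        by (simp only: functional.span_sum functional.span_scale functional.span_base imageI)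
    qed
  qed
  ultimately show ?thesis using that card_image[OF inj] by simp
qed

end

section \<open>Traces\<close>

lemma linear_on_space_sum:
  assumes "functional.subspace V" "linear_on_space V L" "\<And>i. i \<in> I \<Longrightarrow> x i \<in> V"
  shows "L (\<Sum>i\<in>I. scale (a i) (x i)) = (\<Sum>i\<in>I. scale (a i) (L (x i)))"
proof -
  have L0: "L 0 = 0"
  proof -
    have "L (scale 0 0) = scale 0 (L 0)"
      using assms(1,2) functional.subspace_0 unfolding linear_on_space_def by blast
    then show ?thesis by (simp only: functional.scale_zero_left functional.scale_zero_right)
  qed
  show ?thesis
    using assms(3)
  proof (induction I rule: infinite_finite_induct)
    case (insert j I)
    have "scale (a j) (x j) \<in> V" "(\<Sum>i\<in>I. scale (a i) (x i)) \<in> V"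
      using insert.prems assms(1) by (auto intro!: functional.subspace_scale functional.subspace_sum)
    then have "L (scale (a j) (x j) + (\<Sum>i\<in>I. scale (a i) (x i))) = scale (a j) (L (x j)) + L (\<Sum>i\<in>I. scale (a i) (x i))"
      using assms(2) insert.prems unfolding linear_on_space_def by (metis insertI1)
    then show ?case
      using insert.IH insert.prems by (simp only: sum.insert[OF insert.hyps] insertI2)
  qed (simp_all only: sum.infinite sum.empty L0 not_False_eq_True)
qed

lemma representation_combination:
  assumes "functional.independent C" "functional.span C = V" "\<And>i. i \<in> I \<Longrightarrow> x i \<in> V"
  shows "functional.representation C (\<Sum>i\<in>I. scale (a i) (x i)) b =
    (\<Sum>i\<in>I. a i * functional.representation C (x i) b)"
proof -
  have x: "x i \<in> functional.span C" if "i \<in> I" for i using assms(2,3) that by blast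
  have "functional.representation C (\<Sum>i\<in>I. scale (a i) (x i)) b =
      (\<Sum>i\<in>I. functional.representation C (scale (a i) (x i)) b)"
    using functional.representation_sum[OF assms(1) functional.span_scale[OF x]] by (rule fun_cong)
  also have "\<dots> = (\<Sum>i\<in>I. a i * functional.representation C (x i) b)"
    by (rule sum.cong[OF refl]) (rule fun_cong[OF functional.representation_scale[OF assms(1) x]])
  finally show ?thesis .
qed

text \<open>Basis independence of the trace. With C the chosen basis, expanding C in B and swapping
  the double sum is the identity tr(S T) = tr(T S) for the two changes of basis.\<close>

lemma trace_on_basis:
  assumes B: "functional.independent B" "functional.span B = V" "finite B"
    and L: "linear_on_space V L" "\<And>v. v \<in> V \<Longrightarrow> L v \<in> V"
  shows "trace_on V L = (\<Sum>b\<in>B. functional.representation B (L b) b)"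
proof -
  define C where "C = (SOME B. functional.independent B \<and> functional.span B = V)"
  have C: "functional.independent C" "functional.span C = V"
    using someI[of "\<lambda>B. functional.independent B \<and> functional.span B = V", OF conjI[OF B(1,2)]]
    unfolding C_def by auto
  \<comment> \<open>An independent set inside the span of the finite B is itself finite.\<close>
  have "finite C"
    using functional.independent_span_bound[OF B(3) C(1)] C(2) B(2) functional.span_superset by blast
  have V: "functional.subspace V" using B(2) functional.subspace_span by blast
  have BV: "b \<in> V" if "b \<in> B" for b using that B(2) functional.span_base by blast
  have CV: "b \<in> V" if "b \<in> C" for b using that C(2) functional.span_base by blast
  let ?r = "functional.representation B" and ?s = "functional.representation C"
  have L_expand: "L c = (\<Sum>b\<in>B. scale (?r c b) (L b))" if "c \<in> V" for c
  proof -
    have "(\<Sum>b\<in>B. scale (?r c b) b) = c"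
      using functional.sum_representation_eq[OF B(1) _ B(3) order_refl] that B(2) by blast
    then have "L c = L (\<Sum>b\<in>B. scale (?r c b) b)" by (rule arg_cong[OF sym])
    also have "\<dots> = (\<Sum>b\<in>B. scale (?r c b) (L b))" by (rule linear_on_space_sum[OF V L(1) BV])
    finally show ?thesis .
  qed
  have "(\<Sum>c\<in>C. ?s (L c) c) = (\<Sum>c\<in>C. \<Sum>b'\<in>B. ?r c b' * ?s (L b') c)"
  proof (rule sum.cong[OF refl])
    fix c assume c: "c \<in> C"
    show "?s (L c) c = (\<Sum>b'\<in>B. ?r c b' * ?s (L b') c)"
      unfolding L_expand[OF CV[OF c]] by (rule representation_combination[OF C L(2)[OF BV]])
  qed
  also have "\<dots> = (\<Sum>b'\<in>B. \<Sum>c\<in>C. ?s (L b') c * ?r c b')"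
    by (subst sum.swap) (simp add: mult.commute)
  also have "\<dots> = (\<Sum>b'\<in>B. ?r (L b') b')"
  proof (rule sum.cong[OF refl])
    fix b assume b: "b \<in> B"
    have "(\<Sum>c\<in>C. scale (?s (L b) c) c) = L b"
      using functional.sum_representation_eq[OF C(1) _ \<open>finite C\<close> order_refl] L(2)[OF BV[OF b]] C(2) by blast
    then have "?r (L b) b = ?r (\<Sum>c\<in>C. scale (?s (L b) c) c) b" by simp
    also have "\<dots> = (\<Sum>c\<in>C. ?s (L b) c * ?r c b)"
      by (rule representation_combination[OF B(1,2) CV])
    finally show "(\<Sum>c\<in>C. ?s (L b) c * ?r c b) = ?r (L b) b" by simp
  qed
  finally show ?thesis by (simp add: trace_on_def C_def[symmetric])
qed

text \<open>Coefficients in a basis are unique, so any expansion formula may replace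
  \<open>functional.representation\<close>; below these coefficients are metric pairings.\<close>

lemma trace_on_dual_basis:
  assumes B: "functional.independent B" "functional.span B = V" "finite B"
    and L: "linear_on_space V L" "\<And>v. v \<in> V \<Longrightarrow> L v \<in> V"
    and \<theta>: "\<And>v. v \<in> V \<Longrightarrow> v = (\<Sum>b\<in>B. scale (\<theta> b v) b)"
  shows "trace_on V L = (\<Sum>b\<in>B. \<theta> b (L b))"
proof (rule trans[OF trace_on_basis[OF B L]], assumption, rule sum.cong[OF refl])
  fix b assume b: "b \<in> B"
  let ?r = "functional.representation B"
  have sp: "b' \<in> functional.span B" if "b' \<in> B" for b' using that by (rule functional.span_base)
  have "?r v b = \<theta> b v" if "v \<in> V" for v
  proof -
    have "?r v b = ?r (\<Sum>b\<in>B. scale (\<theta> b v) b) b" using \<theta>[OF that] by simp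
    also have "\<dots> = (\<Sum>b'\<in>B. \<theta> b' v * ?r b' b)"
      by (rule representation_combination[OF B(1,2)]) (use sp B(2) in blast)
    also have "\<dots> = (\<Sum>b'\<in>B. if b' = b then \<theta> b' v else 0)"
      by (intro sum.cong refl) (simp add: functional.representation_basis[OF B(1)])
    also have "\<dots> = \<theta> b v" using B(3) b by simp
    finally show ?thesis .
  qed
  then show "?r (L b) b = \<theta> b (L b)" using L(2) b B(2) functional.span_base by blast
qed

section \<open>Curvature in a single tangent space\<close>

text \<open>Only the linear algebra of one tangent space is kept, so that the curvature computation
  can treat R as an arbitrary algebraic curvature tensor.\<close>

locale paracontact_space =
  fixes V :: "('a \<Rightarrow> real) set" and \<phi> :: "('a \<Rightarrow> real) \<Rightarrow> ('a \<Rightarrow> real)" and \<eta> :: "('a \<Rightarrow> real) \<Rightarrow> real"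
    and \<xi> :: "'a \<Rightarrow> real" and g :: "('a \<Rightarrow> real) \<Rightarrow> ('a \<Rightarrow> real) \<Rightarrow> real"
  assumes V: "functional.subspace V"
    and dim3: "\<exists>B. functional.independent B \<and> functional.span B = V \<and> finite B \<and> card B = 3"
    and \<phi>: "linear_on_space V \<phi>" "\<And>v. v \<in> V \<Longrightarrow> \<phi> v \<in> V"
    and \<eta>: "linear_form_on V \<eta>"
    and \<xi>: "\<xi> \<in> V" "\<phi> \<xi> = 0" "\<eta> \<xi> = 1"
    and g: "\<And>v. v \<in> V \<Longrightarrow> linear_form_on V (g v)" "\<And>v w. v \<in> V \<Longrightarrow> w \<in> V \<Longrightarrow> g v w = g w v"
      "\<And>v. v \<in> V \<Longrightarrow> (\<And>w. w \<in> V \<Longrightarrow> g v w = 0) \<Longrightarrow> v = 0"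
    and \<eta>\<phi>: "\<And>v. v \<in> V \<Longrightarrow> \<eta> (\<phi> v) = 0"
    and \<phi>\<phi>: "\<And>v. v \<in> V \<Longrightarrow> \<phi> (\<phi> v) = v - scale (\<eta> v) \<xi>"
    and g\<phi>: "\<And>v w. v \<in> V \<Longrightarrow> w \<in> V \<Longrightarrow> g (\<phi> v) (\<phi> w) = - g v w + \<eta> v * \<eta> w"
begin

lemmas V_0 = functional.subspace_0[OF V]
lemmas V_add = functional.subspace_add[OF V]
lemmas V_diff = functional.subspace_diff[OF V]
lemmas V_scale = functional.subspace_scale[OF V]
lemmas V_intros = V_0 V_add V_diff V_scale \<phi>(2) \<xi>(1)

lemma form_simps:
  assumes "linear_form_on V l" "v \<in> V"
  shows "w \<in> V \<Longrightarrow> l (v + w) = l v + l w" "l (scale a v) = a * l v" "w \<in> V \<Longrightarrow> l (v - w) = l v - l w" "l 0 = 0"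
proof -
  show add: "l (v + w) = l v + l w" if "w \<in> V" for w using assms that by (auto simp: linear_form_on_def)
  have sc: "l (scale a v) = a * l v" if "v \<in> V" for a v using assms that by (auto simp: linear_form_on_def)
  show "l (scale a v) = a * l v" using assms sc by simp
  have m: "v - w = v + scale (-1) w" for w by (auto simp: scale_def fun_eq_iff)
  show "l (v - w) = l v - l w" if "w \<in> V"
    unfolding m using that add[OF V_scale[OF that, of "-1"]] sc[OF that, of "-1"] by simp
  show "l 0 = 0" using sc[OF assms(2), of 0] by (simp only: functional.scale_zero_left mult_zero_left)
qed

lemmas \<eta>_simps = form_simps[OF \<eta>]
lemmas g_right = form_simps[OF g(1)]

lemma g_left:
  assumes "v \<in> V" "z \<in> V"
  shows "w \<in> V \<Longrightarrow> g (v + w) z = g v z + g w z" "g (scale a v) z = a * g v z"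
    "w \<in> V \<Longrightarrow> g (v - w) z = g v z - g w z" "g 0 z = 0"
  using assms by (simp_all add: g(2)[of _ z] V_intros g_right del: plus_fun_apply)

text \<open>Put \<xi> as second argument in the compatibility of g and \<phi>; the left side
  vanishes because \<phi> \<xi> = 0.\<close>

lemma g_\<xi>: "v \<in> V \<Longrightarrow> g v \<xi> = \<eta> v" "v \<in> V \<Longrightarrow> g \<xi> v = \<eta> v"
proof -
  assume v: "v \<in> V"
  show "g v \<xi> = \<eta> v" using g\<phi>[OF v \<xi>(1)] g_right(4)[OF \<phi>(2)[OF v] v] by (simp add: \<xi>)
  then show "g \<xi> v = \<eta> v" using g(2)[OF v \<xi>(1)] by simp
qed

text \<open>On ker \<eta> the map \<phi> squares to the identity, so u + \<phi> u and u - \<phi> u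
  are eigenvectors; the sign a treats both at once.\<close>

lemma \<phi>_eigenvector:
  assumes u: "u \<in> V" "\<eta> u = 0" and a: "a = 1 \<or> a = - 1"
  shows "\<phi> (u + scale a (\<phi> u)) = scale a (u + scale a (\<phi> u))" "\<eta> (u + scale a (\<phi> u)) = 0"
proof -
  have "\<phi> (u + scale a (\<phi> u)) = \<phi> u + scale a (\<phi> (\<phi> u))"
    using \<phi> u V_intros unfolding linear_on_space_def by metis
  also have "\<phi> (\<phi> u) = u" using \<phi>\<phi>[OF u(1)] u(2) by (simp add: functional.scale_zero_left)
  also have "\<phi> u + scale a u = scale a (u + scale a (\<phi> u))"
    using a by (auto simp: scale_def fun_eq_iff)
  finally show "\<phi> (u + scale a (\<phi> u)) = scale a (u + scale a (\<phi> u))" .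
  show "\<eta> (u + scale a (\<phi> u)) = 0"
    using u \<eta>\<phi> by (simp add: \<eta>_simps V_intros del: plus_fun_apply)
qed

text \<open>If the projection to ker \<eta> killed a whole basis, three independent vectors would
  lie on the line through \<xi>.\<close>

lemma exists_horizontal: obtains u where "u \<in> V" "\<eta> u = 0" "u \<noteq> 0"
proof -
  obtain B where B: "functional.independent B" "functional.span B = V" "finite B" "card B = 3"
    using dim3 by blast
  have "\<exists>b\<in>B. b - scale (\<eta> b) \<xi> \<noteq> 0"
  proof (rule ccontr)
    assume "\<not> ?thesis"
    then have "b = scale (\<eta> b) \<xi>" if "b \<in> B" for b using that by auto
    then have "B \<subseteq> functional.span {\<xi>}"
      by (metis functional.span_base functional.span_scale singletonI subsetI)
    then have "card B \<le> card {\<xi>}"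
      using functional.independent_span_bound[of "{\<xi>}" B] B(1) by blast
    then show False using B(4) by simp
  qed
  then obtain b where b: "b \<in> B" "b - scale (\<eta> b) \<xi> \<noteq> 0" by blast
  then have "b \<in> V" using B(2) functional.span_base by blast
  then show ?thesis
    using that[of "b - scale (\<eta> b) \<xi>"] b(2) by (simp add: V_intros \<eta>_simps \<xi>)
qed

text \<open>On ker \<eta> the map \<phi> reverses the sign of g, so each eigenspace is isotropic;
  nondegeneracy then forces a nonzero pairing between the two eigenspaces, which is rescaled to
  1.\<close>

lemma null_frame:
  obtains e f where "e \<in> V" "f \<in> V" "\<eta> e = 0" "\<eta> f = 0" "\<phi> e = e" "\<phi> f = - f"
    "g e e = 0" "g f f = 0" "g e f = 1" "g f e = 1"
proof -
  obtain u where u: "u \<in> V" "\<eta> u = 0" "u \<noteq> 0" by (rule exists_horizontal)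
  obtain w' where w': "w' \<in> V" "g u w' \<noteq> 0" using g(3)[OF u(1)] u(3) by blast
  define w where "w = w' - scale (\<eta> w') \<xi>"
  have w: "w \<in> V" "\<eta> w = 0" "g u w \<noteq> 0"
    using w' u by (simp_all add: w_def V_intros \<eta>_simps \<xi> g_right g_\<xi>)
  define P where "P x = x + scale 1 (\<phi> x)" for x
  define N where "N x = x + scale (-1) (\<phi> x)" for x
  have P: "P x \<in> V" "\<phi> (P x) = P x" "\<eta> (P x) = 0" if "x \<in> V" "\<eta> x = 0" for x
    using \<phi>_eigenvector[OF that, of 1] that by (simp_all add: P_def V_intros functional.scale_one del: plus_fun_apply)
  have N: "N x \<in> V" "\<phi> (N x) = - N x" "\<eta> (N x) = 0" if "x \<in> V" "\<eta> x = 0" for x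
  proof -
    have "scale (-1) y = - y" for y :: "'a \<Rightarrow> real" by (auto simp: scale_def)
    then show "N x \<in> V" "\<phi> (N x) = - N x" "\<eta> (N x) = 0"
      using \<phi>_eigenvector[OF that, of "-1"] that V_intros unfolding N_def by metis+
  qed
  have minus: "- x = scale (-1) x" for x :: "'a \<Rightarrow> real" by (auto simp: scale_def)
  have null: "g x y = 0" if "x \<in> V" "y \<in> V" "\<eta> x = 0" "\<phi> x = x \<and> \<phi> y = y \<or> \<phi> x = - x \<and> \<phi> y = - y" for x y
  proof -
    have "g (- x) (- y) = g x y"
      unfolding minus using that(1,2) by (simp only: g_left g_right V_intros)
    then have "g (\<phi> x) (\<phi> y) = g x y" using that(4) by (elim disjE conjE) (simp_all only:)
    then show ?thesis using g\<phi>[OF that(1,2)] that(3) by simp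
  qed
  \<comment> \<open>P and N are twice the eigenprojections, hence the factor 4. Expanding the left
    side leaves only the mixed terms, so at least one of them is nonzero.\<close>
  have "g (P u + N u) (P w + N w) = 4 * g u w"
  proof -
    have "P x + N x = scale 2 x" for x by (auto simp: P_def N_def scale_def)
    then show ?thesis using u w by (simp add: g_left g_right V_intros del: plus_fun_apply)
  qed
  moreover have "g (P u + N u) (P w + N w) = g (P u) (N w) + g (N u) (P w)"
    using P[OF u(1,2)] P[OF w(1,2)] N[OF u(1,2)] N[OF w(1,2)]
    by (simp add: g_left g_right V_intros null del: plus_fun_apply)
  ultimately have "g (P u) (N w) \<noteq> 0 \<or> g (P w) (N u) \<noteq> 0"
    using w(3) g(2) P[OF w(1,2)] N[OF u(1,2)] by auto
  then obtain x y where x: "x \<in> V" "\<phi> x = x" "\<eta> x = 0" and y: "y \<in> V" "\<phi> y = - y" "\<eta> y = 0" and xy: "g x y \<noteq> 0"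
    using P N u w by metis
  define f where "f = scale (inverse (g x y)) y"
  have f: "f \<in> V" "\<eta> f = 0" "g x f = 1"
    using y x xy by (simp_all add: f_def V_intros \<eta>_simps g_right)
  have "\<phi> f = scale (inverse (g x y)) (\<phi> y)" using \<phi>(1) y(1) unfolding f_def linear_on_space_def by blast
  then have "\<phi> f = - f" unfolding y(2) f_def by (auto simp: scale_def)
  show ?thesis
    using that[of x f] x f \<open>\<phi> f = - f\<close> null[of x x] null[of f f] g(2)[of x f] by simp
qed

text \<open>As e and f are null with g e f = 1, pairing with f reads off the coefficient of e and
  vice versa, and \<eta> that of \<xi>. Independence follows, and spanning from the
  dimension.\<close>

lemma frame_basis:
  assumes e: "e \<in> V" "\<eta> e = 0" "g e e = 0" and f: "f \<in> V" "\<eta> f = 0" "g f f = 0" and ef: "g e f = 1" "g f e = 1"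
  shows "functional.independent {e, f, \<xi>}" "functional.span {e, f, \<xi>} = V" "card {e, f, \<xi>} = 3"
    "v \<in> V \<Longrightarrow> v = scale (g v f) e + scale (g v e) f + scale (\<eta> v) \<xi>"
proof -
  have ne: "e \<noteq> f" "e \<noteq> \<xi>" "f \<noteq> \<xi>" using e f ef \<xi> by auto
  show c3: "card {e, f, \<xi>} = 3" using ne by simp
  have coord: "a = 0 \<and> b = 0 \<and> c = 0" if "scale a e + scale b f + scale c \<xi> = 0" for a b c
  proof -
    let ?v = "scale a e + scale b f + scale c \<xi>"
    have "g ?v f = a" "g ?v e = b" "\<eta> ?v = c"
      using e f ef \<xi> by (simp_all add: g_left \<eta>_simps V_intros g_\<xi> del: plus_fun_apply)
    then show ?thesis using that g_left(4)[OF e(1) e(1)] g_left(4)[OF f(1) f(1)] \<eta>_simps(4)[OF e(1)] by metis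
  qed
  have ind: "\<forall>v\<in>T. u v = 0" if T: "finite T" "T \<subseteq> {e, f, \<xi>}" and s: "(\<Sum>v\<in>T. scale (u v) v) = 0" for T u
  proof -
    \<comment> \<open>Coefficients on a subset T are padded by 0, so that the three-term relation
      covers every T.\<close>
    define u' where "u' v = (if v \<in> T then u v else 0)" for v
    have "(\<Sum>v\<in>{e, f, \<xi>}. scale (u' v) v) = (\<Sum>v\<in>T. scale (u v) v)"
      by (rule sum.mono_neutral_cong_right) (use T in \<open>auto simp: u'_def scale_def fun_eq_iff\<close>)
    then have "scale (u' e) e + scale (u' f) f + scale (u' \<xi>) \<xi> = 0"
      using s ne by (simp add: add.assoc del: plus_fun_apply)
    from coord[OF this] have "\<forall>v\<in>{e, f, \<xi>}. u' v = 0" by simp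
    then show ?thesis
      using T(2) unfolding u'_def by (intro ballI) (drule (1) subsetD, drule (1) bspec, simp)
  qed
  show indep: "functional.independent {e, f, \<xi>}"
    unfolding functional.independent_explicit_module by (intro allI impI) (drule (2) ind, simp)
  obtain B where B: "functional.independent B" "functional.span B = V" "finite B" "card B = 3"
    using dim3 by blast
  have sub: "functional.span {e, f, \<xi>} \<subseteq> V" using e f \<xi> V by (intro functional.span_minimal) auto
  show span: "functional.span {e, f, \<xi>} = V"
  proof (rule ccontr)
    assume "functional.span {e, f, \<xi>} \<noteq> V"
    then obtain x where x: "x \<in> V" "x \<notin> functional.span {e, f, \<xi>}" using sub by blast
    then have "functional.independent (insert x {e, f, \<xi>})" by (intro functional.independent_insertI indep)
    moreover have "insert x {e, f, \<xi>} \<subseteq> functional.span B" using e f \<xi> x B(2) by auto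
    ultimately have "card (insert x {e, f, \<xi>}) \<le> 3"
      using functional.independent_span_bound[OF B(3)] B(4) by metis
    moreover have "x \<notin> {e, f, \<xi>}" by (rule contrapos_nn[OF x(2) functional.span_base])
    ultimately show False using c3 by simp
  qed
  assume v: "v \<in> V"
  then obtain a b c where v_eq: "v = scale a e + scale b f + scale c \<xi>"
  proof -
    have "v \<in> functional.span (insert e (insert f (insert \<xi> {})))" using v span by simp
    then obtain a b c where "v - scale a e - scale b f - scale c \<xi> = 0"
      unfolding functional.span_insert functional.span_empty by auto
    then have "v = scale a e + scale b f + scale c \<xi>" by (simp add: algebra_simps fun_eq_iff)
    then show ?thesis by (rule that)
  qed
  have "g v f = a" "g v e = b" "\<eta> v = c"
    unfolding v_eq using e f ef \<xi> by (simp_all add: g_left \<eta>_simps V_intros g_\<xi> del: plus_fun_apply)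
  then show "v = scale (g v f) e + scale (g v e) f + scale (\<eta> v) \<xi>" using v_eq by simp
qed

lemma trace_frame:
  assumes e: "e \<in> V" "\<eta> e = 0" "g e e = 0" and f: "f \<in> V" "\<eta> f = 0" "g f f = 0" and ef: "g e f = 1" "g f e = 1"
    and L: "linear_on_space V L" "\<And>v. v \<in> V \<Longrightarrow> L v \<in> V"
  shows "trace_on V L = g (L e) f + g (L f) e + g (L \<xi>) \<xi>"
proof -
  note fb = frame_basis[OF e f ef]
  have ne: "e \<noteq> f" "e \<noteq> \<xi>" "f \<noteq> \<xi>" using e f ef \<xi> by auto
  define \<theta> where "\<theta> b v = (if b = e then g v f else if b = f then g v e else \<eta> v)" for b v
  have "v = (\<Sum>b\<in>{e, f, \<xi>}. scale (\<theta> b v) b)" if "v \<in> V" for v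
    using fb(4)[OF that] ne by (simp add: \<theta>_def add.assoc del: plus_fun_apply)
  from trace_on_dual_basis[OF fb(1,2) _ L this] show ?thesis
    using ne L(2)[OF \<xi>(1)] by (simp add: \<theta>_def g_\<xi>)
qed

text \<open>In dimension 3 an algebraic curvature tensor has six components, indexed by symmetric
  combinations of the pairs e f, e \<xi>, f \<xi>. The value of R on \<xi> fixes the five that
  involve \<xi>, leaving k = r e f e f.\<close>

lemma sasakian_curvature:
  assumes RV: "\<And>a b c. a \<in> V \<Longrightarrow> b \<in> V \<Longrightarrow> c \<in> V \<Longrightarrow> R a b c \<in> V"
    and R1: "\<And>b c. b \<in> V \<Longrightarrow> c \<in> V \<Longrightarrow> linear_on_space V (\<lambda>a. R a b c)"
    and R2: "\<And>a c. a \<in> V \<Longrightarrow> c \<in> V \<Longrightarrow> linear_on_space V (\<lambda>b. R a b c)"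
    and R3: "\<And>a b. a \<in> V \<Longrightarrow> b \<in> V \<Longrightarrow> linear_on_space V (\<lambda>c. R a b c)"
    and anti: "\<And>a b c. a \<in> V \<Longrightarrow> b \<in> V \<Longrightarrow> c \<in> V \<Longrightarrow> R a b c = - R b a c"
    and skew: "\<And>a b c d. a \<in> V \<Longrightarrow> b \<in> V \<Longrightarrow> c \<in> V \<Longrightarrow> d \<in> V \<Longrightarrow> g (R a b c) d = - g (R a b d) c"
    and bianchi: "\<And>a b c. a \<in> V \<Longrightarrow> b \<in> V \<Longrightarrow> c \<in> V \<Longrightarrow> R a b c + R b c a + R c a b = 0"
    and R\<xi>: "\<And>a b. a \<in> V \<Longrightarrow> b \<in> V \<Longrightarrow> R a b \<xi> = scale (\<eta> a) b - scale (\<eta> b) a"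
  defines "Rc v w \<equiv> trace_on V (\<lambda>u. R u v w)"
  obtains s where
    "\<And>v w. v \<in> V \<Longrightarrow> w \<in> V \<Longrightarrow> Rc v w = s * g v w - (s + 2) * \<eta> v * \<eta> w"
    "metric_trace_on V g Rc = 2 * s - 2"
    "\<And>u. u \<in> V \<Longrightarrow> \<eta> u = 0 \<Longrightarrow> g (R u (\<phi> u) u) (\<phi> u) = (s + 1) * (g u u)\<^sup>2"
    "\<exists>u\<in>V. g (\<phi> u) (\<phi> u) \<noteq> 0"
proof -
  obtain e f where e: "e \<in> V" "\<eta> e = 0" "\<phi> e = e" "g e e = 0" and f: "f \<in> V" "\<eta> f = 0" "\<phi> f = - f" "g f f = 0"
    and ef: "g e f = 1" "g f e = 1"
    by (rule null_frame)
  note fr = e(1,2,4) f(1,2,4) ef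
  note tr = trace_frame[OF fr]
  define r where "r a b c d = g (R a b c) d" for a b c d
  have minus: "- x = scale (-1) x" for x :: "'a \<Rightarrow> real" by (auto simp: scale_def)
  have r_lin:
    "r (a + a') b c d = r a b c d + r a' b c d" "r (scale t a) b c d = t * r a b c d"
    "r a (b + b') c d = r a b c d + r a b' c d" "r a (scale t b) c d = t * r a b c d"
    "r a b (c + c') d = r a b c d + r a b c' d" "r a b (scale t c) d = t * r a b c d"
    "r a b c (d + d') = r a b c d + r a b c d'" "r a b c (scale t d) = t * r a b c d"
    if "a \<in> V" "b \<in> V" "c \<in> V" "d \<in> V" "a' \<in> V" "b' \<in> V" "c' \<in> V" "d' \<in> V" for a b c d a' b' c' d' t
    using R1[OF that(2,3)] R2[OF that(1,3)] R3[OF that(1,2)] that RV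
    unfolding r_def linear_on_space_def by (simp_all add: g_left g_right del: plus_fun_apply)
  have r_anti: "r a b c d = - r b a c d" and r_skew: "r a b c d = - r a b d c"
    and r_bianchi: "r a b c d + r b c a d + r c a b d = 0"
    if "a \<in> V" "b \<in> V" "c \<in> V" "d \<in> V" for a b c d
  proof -
    show "r a b c d = - r b a c d" unfolding r_def by (subst anti[OF that(1-3)]) (simp only: minus g_left that RV mult_minus1)
    show "r a b c d = - r a b d c" unfolding r_def by (rule skew[OF that])
    have "r a b c d + r b c a d + r c a b d = g (R a b c + R b c a + R c a b) d"
      unfolding r_def using that RV by (simp add: g_left V_intros del: plus_fun_apply)
    also have "\<dots> = 0" using bianchi[OF that(1-3)] g_left(4)[OF that(4,4)] by metis
    finally show "r a b c d + r b c a d + r c a b d = 0" .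
  qed
  have r_\<xi>: "r a b \<xi> d = \<eta> a * g b d - \<eta> b * g a d" if "a \<in> V" "b \<in> V" "d \<in> V" for a b d
    unfolding r_def using that by (simp add: R\<xi> g_left V_intros)
  define k where "k = r e f e f"
  have Rc: "Rc v w = r e v w f + r f v w e + r \<xi> v w \<xi>" if "v \<in> V" "w \<in> V" for v w
    unfolding Rc_def r_def using R1 RV that by (intro tr) auto
  have diag: "r a a c d = 0" if "a \<in> V" "c \<in> V" "d \<in> V" for a c d using r_anti[of a a c d] that by simp
  have skew0: "r a b c c = 0" if "a \<in> V" "b \<in> V" "c \<in> V" for a b c using r_skew[of a b c c] that by simp
  note z = diag skew0 e(1) f(1) \<xi>(1)
  have r\<xi>: "r \<xi> b c \<xi> = \<eta> b * \<eta> c - g b c" if "b \<in> V" "c \<in> V" for b c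
    using r_skew[of \<xi> b c \<xi>] r_\<xi>[of \<xi> b c] that \<xi> by (simp add: g_\<xi>)
  have fe: "r f e f e = k" "r f e e f = - k" "r e f f e = - k"
    using r_skew[of f e f e] r_anti[of f e e f] r_skew[of e f f e] z by (auto simp: k_def)
  \<comment> \<open>In \<open>Rc e f\<close> the component r f e f e contributes k and r \<xi> e f
    \<xi> contributes - g e f = -1, so k = s + 1 below. \<open>Rc \<xi> \<xi>\<close> collects -1
    from each of e and f, whence the coefficient s + 2 of \<eta> \<otimes> \<eta>.\<close>
  have Rc_frame:
    "Rc e e = 0" "Rc f f = 0" "Rc e f = k - 1" "Rc f e = k - 1" "Rc e \<xi> = 0" "Rc f \<xi> = 0" "Rc \<xi> \<xi> = - 2"
    using e f ef \<xi>
    by (simp_all add: Rc z r\<xi> fe r_\<xi> g_\<xi>) (simp_all add: k_def)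
  \<comment> \<open>Symmetry of the Ricci form has not been derived at this point. The Bianchi
    identity moves \<xi> into the third slot, where R is known.\<close>
  have Rc_\<xi>: "Rc \<xi> e = 0" "Rc \<xi> f = 0"
  proof -
    have "r e \<xi> e f = - r e \<xi> f e" "r f \<xi> f e = - r f \<xi> e f" using r_skew z by blast+
    moreover have "r e \<xi> f e + r \<xi> f e e + r f e \<xi> e = 0" "r f \<xi> e f + r \<xi> e f f + r e f \<xi> f = 0"
      using r_bianchi z by blast+
    ultimately show "Rc \<xi> e = 0" "Rc \<xi> f = 0"
      using e f \<xi> by (simp_all add: Rc z r_\<xi>)
  qed
  define s where "s = k - 1"
  have frame: "v = scale (g v f) e + scale (g v e) f + scale (\<eta> v) \<xi>" if "v \<in> V" for v
    by (rule frame_basis(4)[OF fr that])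
  have Rc_lin: "Rc (a + a') b = Rc a b + Rc a' b" "Rc (scale t a) b = t * Rc a b"
    "Rc a (b + b') = Rc a b + Rc a b'" "Rc a (scale t b) = t * Rc a b"
    if "a \<in> V" "b \<in> V" "a' \<in> V" "b' \<in> V" for a b a' b' t
    using that z by (simp_all add: Rc V_intros r_lin algebra_simps del: plus_fun_apply)
  have Rc_eq: "Rc v w = s * g v w - (s + 2) * \<eta> v * \<eta> w" if "v \<in> V" "w \<in> V" for v w
  proof -
    have exp: "Rc (scale a e + scale b f + scale c \<xi>) (scale a' e + scale b' f + scale c' \<xi>) =
        s * (a * b' + b * a') - 2 * c * c'" for a b c a' b' c'
      using z by (simp add: Rc_lin V_intros Rc_frame Rc_\<xi> s_def algebra_simps del: plus_fun_apply)
    have gexp: "g (scale a e + scale b f + scale c \<xi>) (scale a' e + scale b' f + scale c' \<xi>) =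
        a * b' + b * a' + c * c'" for a b c a' b' c'
      using z e f ef \<xi> by (simp add: g_left g_right \<eta>_simps V_intros g_\<xi> algebra_simps del: plus_fun_apply)
    have "Rc v w = s * (g v f * g w e + g v e * g w f) - 2 * \<eta> v * \<eta> w"
      using exp frame[OF that(1)] frame[OF that(2)] by metis
    moreover have "g v w = g v f * g w e + g v e * g w f + \<eta> v * \<eta> w"
      using gexp frame[OF that(1)] frame[OF that(2)] by metis
    ultimately show ?thesis by (simp add: algebra_simps)
  qed
  have "metric_trace_on V g Rc = 2 * s - 2"
  proof -
    define Q where "Q = (\<lambda>v. THE u. u \<in> V \<and> (\<forall>w\<in>V. g u w = Rc v w))"
    \<comment> \<open>The formula for \<open>Rc\<close> displays a candidate for the Ricci operator;
      nondegeneracy of g makes it the unique one, which evaluates the \<open>THE\<close>.\<close>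
    have Q: "Q v = scale s v - scale ((s + 2) * \<eta> v) \<xi>" if v: "v \<in> V" for v
      unfolding Q_def
    proof (rule the_equality)
      show *: "scale s v - scale ((s + 2) * \<eta> v) \<xi> \<in> V \<and> (\<forall>w\<in>V. g (scale s v - scale ((s + 2) * \<eta> v) \<xi>) w = Rc v w)"
        using v by (simp add: V_intros Rc_eq g_left g_\<xi>)
      fix u assume u: "u \<in> V \<and> (\<forall>w\<in>V. g u w = Rc v w)"
      have "u - (scale s v - scale ((s + 2) * \<eta> v) \<xi>) = 0"
        using u * by (intro g(3)) (auto simp: V_intros g_left simp del: minus_apply)
      then show "u = scale s v - scale ((s + 2) * \<eta> v) \<xi>" by simp
    qed
    have "linear_on_space V Q"
      unfolding linear_on_space_def
      by (auto simp: Q V_intros \<eta>_simps simp del: plus_fun_apply) (auto simp: scale_def fun_eq_iff algebra_simps)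
    then have "trace_on V Q = g (Q e) f + g (Q f) e + g (Q \<xi>) \<xi>"
      by (rule tr) (simp add: Q V_intros)
    \<comment> \<open>The identity has trace 3 and \<eta> \<otimes> \<xi> has trace 1, so the trace
      is 3 s - (s + 2).\<close>
    also have "\<dots> = 2 * s - 2" using e f ef \<xi> by (simp add: Q V_intros g_left \<eta>_simps g_\<xi>)
    finally show ?thesis by (simp add: metric_trace_on_def Q_def)
  qed
  moreover have "g (R u (\<phi> u) u) (\<phi> u) = (s + 1) * (g u u)\<^sup>2" if u: "u \<in> V" "\<eta> u = 0" for u
  proof -
    define a b where "a = g u f" and "b = g u e"
    have ue: "u = scale a e + scale b f"
      using frame[OF u(1)] u(2) by (simp add: a_def b_def functional.scale_zero_left)
    have "\<phi> u = scale a (\<phi> e) + scale b (\<phi> f)"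
      unfolding ue using \<phi>(1) z V_intros unfolding linear_on_space_def by metis
    then have pu: "\<phi> u = scale a e + scale (- b) f"
      unfolding e(3) f(3) by (auto simp: scale_def)
    \<comment> \<open>The two vectors have determinant a (c - b) in the frame e, f, and the
      component scales by its square. For c = - b this is 4 a^2 b^2 k, to be compared with g u u = 2
      a b.\<close>
    have r_exp: "r (scale a e + scale b f) (scale a e + scale c f) (scale a e + scale b f) (scale a e + scale c f) =
        a\<^sup>2 * (c - b)\<^sup>2 * k" for c
      using z fe
      by (simp add: r_lin V_intros k_def[symmetric] power2_eq_square algebra_simps del: plus_fun_apply)
    have "r u (\<phi> u) u (\<phi> u) = r (scale a e + scale b f) (scale a e + scale (- b) f) (scale a e + scale b f) (scale a e + scale (- b) f)"
      by (simp only: pu ue[symmetric])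
    also have "\<dots> = 4 * a\<^sup>2 * b\<^sup>2 * k" unfolding r_exp by (simp add: power2_eq_square)
    finally have "r u (\<phi> u) u (\<phi> u) = 4 * a\<^sup>2 * b\<^sup>2 * k" .
    moreover have "g u u = 2 * a * b"
      unfolding ue using z e f ef by (simp add: g_left g_right V_intros del: plus_fun_apply)
    ultimately show ?thesis by (simp add: r_def s_def power2_eq_square)
  qed
  moreover have "\<exists>u\<in>V. g (\<phi> u) (\<phi> u) \<noteq> 0"
  proof
    \<comment> \<open>\<phi> sends this witness to e - f, whose square under g is -2.\<close>
    show "e + f \<in> V" using z by (simp add: V_add)
    show "g (\<phi> (e + f)) (\<phi> (e + f)) \<noteq> 0"
      using z e f ef by (simp add: g\<phi> \<eta>_simps g_left g_right V_intros del: plus_fun_apply)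
  qed
  ultimately show ?thesis using that Rc_eq by blast
qed

end

section \<open>The Levi-Civita connection and its curvature\<close>

text \<open>Near each point s is a quotient W / H, and the quotient rule gives it derivative 0 at
  that point. In a chart, s is therefore constant on a ball, and connectedness does the
  rest.\<close>

lemma (in manifold) locally_constant_ratio:
  assumes conn: "connected (UNIV :: 'm set)"
    and loc: "\<And>p. \<exists>W\<in>sf. \<exists>H\<in>sf. (\<forall>q. W q = s q * H q) \<and> H p \<noteq> 0 \<and> (\<forall>v\<in>TS p. v W = s p * v H)"
  shows "\<exists>c. \<forall>p. s p = c"
proof -
  have "\<exists>T. openin (top_of_set UNIV) T \<and> p \<in> T \<and> (\<forall>q\<in>T. s q = s p)" for p
  proof -
    obtain U c where U: "(U, c) \<in> A" "p \<in> U" by (rule chart_exists)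
    note Ud = chartD[OF U(1)]
    obtain r where r: "r > 0" "ball (c p) r \<subseteq> c ` U"
      using Ud(2) U(2) by (meson imageI open_contains_ball)
    let ?t = "\<lambda>x. s (inv_into U c x)"
    have "(?t has_derivative (\<lambda>w. 0)) (at x)" if xr: "x \<in> ball (c p) r" for x
    proof -
      obtain q where q: "q \<in> U" "x = c q" using subsetD[OF r(2) xr] by (rule imageE) (rule that)
      obtain W H where WH: "W \<in> sf" "H \<in> sf" "\<And>q. W q = s q * H q" "H q \<noteq> 0" "\<And>v. v \<in> TS q \<Longrightarrow> v W = s q * v H"
        using loc[of q] by blast
      let ?w = "W \<circ> inv_into U c" and ?h = "H \<circ> inv_into U c"
      let ?D = "\<lambda>f w. coord_deriv U c q w f"
      have x: "inv_into U c x = q" using q Ud(4) by simp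
      have hx: "?h x \<noteq> 0" using WH(4) x by simp
      have "((\<lambda>y. ?w y / ?h y) has_derivative
          (\<lambda>w. - ?w x * (inverse (?h x) * ?D H w * inverse (?h x)) + ?D W w / ?h x)) (at x)"
        using has_derivative_divide[OF sf_chart_derivative[OF U(1) q(1) WH(1)] sf_chart_derivative[OF U(1) q(1) WH(2)]] hx
        unfolding q(2) .
      moreover have "- ?w x * (inverse (?h x) * ?D H w * inverse (?h x)) + ?D W w / ?h x = 0" for w
        using WH(3,4) WH(5)[OF coord_deriv_tangent[OF U(1) q(1)]] by (simp add: x field_simps)
      ultimately have D: "((\<lambda>y. ?w y / ?h y) has_derivative (\<lambda>w. 0)) (at x)" by simp
      have cont: "continuous_on (c ` U) ?h" by (rule smooth_on_continuous[OF sfD[OF WH(2) U(1)]])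
      \<comment> \<open>W and H belong to the single point q. By continuity of H, the quotient
        agrees with s on a neighbourhood of x, so the derivative at x transfers to s.\<close>
      have "open (c ` U \<inter> ?h -` (- {0}))"
        by (rule continuous_open_preimage[OF cont Ud(2)]) auto
      from has_derivative_transform_within_open[OF D this] show ?thesis
        using hx q WH(3) by auto
    qed
    then obtain k where k: "\<And>x. x \<in> ball (c p) r \<Longrightarrow> ?t x = k"
      using has_derivative_zero_constant[OF convex_ball, of "c p" r ?t] by (metis has_derivative_at_withinI)
    have "open (U \<inter> c -` ball (c p) r)"
      by (rule continuous_open_preimage[OF Ud(5,1)]) simp
    moreover have "s q = k" if "q \<in> U \<inter> c -` ball (c p) r" for q
      using k[of "c q"] that Ud(4)[of q] by auto
    moreover have "p \<in> U \<inter> c -` ball (c p) r" using U(2) r(1) by simp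
    ultimately show ?thesis by (intro exI[of _ "U \<inter> c -` ball (c p) r"]) auto
  qed
  then have "s constant_on UNIV" by (intro locally_constant_imp_constant[OF conn]) auto
  then show ?thesis by (simp add: constant_on_def)
qed

locale levi_civita_manifold = manifold A
  for A :: "('m::{t2_space, second_countable_topology}, 'e::euclidean_space) chart set" +
  fixes g :: "'m tensor02" and nabla :: "'m connection"
  assumes metric: "pseudo_riemannian_metric A g"
    and levi_civita: "levi_civita_connection A g nabla"
begin

section \<open>Calculus of a torsion-free metric connection\<close>

lemma nabla_vf: "X \<in> vf \<Longrightarrow> Y \<in> vf \<Longrightarrow> nabla X Y \<in> vf"
  and nabla_add: "X \<in> vf \<Longrightarrow> Y \<in> vf \<Longrightarrow> Z \<in> vf \<Longrightarrow> nabla (X + Y) Z = nabla X Z + nabla Y Z"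
    "X \<in> vf \<Longrightarrow> Y \<in> vf \<Longrightarrow> Z \<in> vf \<Longrightarrow> nabla X (Y + Z) = nabla X Y + nabla X Z"
  and nabla_scale: "f \<in> sf \<Longrightarrow> X \<in> vf \<Longrightarrow> Y \<in> vf \<Longrightarrow> nabla (scale_field f X) Y = scale_field f (nabla X Y)"
    "f \<in> sf \<Longrightarrow> X \<in> vf \<Longrightarrow> Y \<in> vf \<Longrightarrow>
      nabla X (scale_field f Y) = scale_field (\<lambda>p. X p f) Y + scale_field f (nabla X Y)"
  and torsion_free: "X \<in> vf \<Longrightarrow> Y \<in> vf \<Longrightarrow> nabla X Y - nabla Y X = lie_bracket X Y"
  using levi_civita unfolding levi_civita_connection_def affine_connection_def by blast+

lemma nabla_diff:
  assumes "X \<in> vf" "Y \<in> vf" "Z \<in> vf"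
  shows "nabla (X - Y) Z = nabla X Z - nabla Y Z" "nabla X (Y - Z) = nabla X Y - nabla X Z"
proof -
  have "nabla (X - Y + Y) Z = nabla (X - Y) Z + nabla Y Z" by (intro nabla_add vf_diff assms)
  then show "nabla (X - Y) Z = nabla X Z - nabla Y Z" by simp
  have "nabla X (Y - Z + Z) = nabla X (Y - Z) + nabla X Z" by (intro nabla_add vf_diff assms)
  then show "nabla X (Y - Z) = nabla X Y - nabla X Z" by simp
qed

lemma metricD:
  assumes "v \<in> TS p"
  shows "linear_form_on (TS p) (g p v)" "w \<in> TS p \<Longrightarrow> g p v w = g p w v"
    "(\<And>w. w \<in> TS p \<Longrightarrow> g p v w = 0) \<Longrightarrow> v = 0"
  using metric assms unfolding pseudo_riemannian_metric_def by blast+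

lemma metric_sf: "X \<in> vf \<Longrightarrow> Y \<in> vf \<Longrightarrow> app02 g X Y \<in> sf"
  using metric unfolding pseudo_riemannian_metric_def by blast

lemma metric_compatible:
  assumes "X \<in> vf" "Y \<in> vf" "Z \<in> vf"
  shows "X p (app02 g Y Z) = g p (nabla X Y p) (Z p) + g p (Y p) (nabla X Z p)"
proof -
  have "cov_deriv02 nabla g X Y Z = 0"
    using levi_civita assms unfolding levi_civita_connection_def by blast
  from fun_cong[OF this, of p] show ?thesis by (simp add: cov_deriv02_def)
qed

lemma metric_right:
  assumes "v \<in> TS p" "w \<in> TS p" "z \<in> TS p"
  shows "g p v (w + z) = g p v w + g p v z" "g p v (scale a w) = a * g p v w" "g p v (w - z) = g p v w - g p v z"
proof -
  show add: "g p v (w + z) = g p v w + g p v z" and sc: "g p v (scale a w) = a * g p v w" for a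
    using metricD(1)[OF assms(1)] assms unfolding linear_form_on_def by blast+
  have "g p v (w - z + z) = g p v (w - z) + g p v z"
    using metricD(1)[OF assms(1)] tangent_minus assms unfolding linear_form_on_def by blast
  then show "g p v (w - z) = g p v w - g p v z" by simp
qed

lemma metric_left:
  assumes "v \<in> TS p" "w \<in> TS p" "z \<in> TS p"
  shows "g p (w + z) v = g p w v + g p z v" "g p (scale a w) v = a * g p w v" "g p (w - z) v = g p w v - g p z v"
  using metric_right[OF assms] assms by (simp_all add: metricD(2)[of _ p v] tangent_add tangent_scale tangent_minus
      del: plus_fun_apply minus_apply)

lemma scale_field_apply: "scale_field f X p h = f p * X p h"
  by (simp add: scale_field_def scale_def)

section \<open>Algebra of the Lie bracket\<close>

lemma lie_bracket_add:
  assumes "X \<in> vf" "Y \<in> vf" "Z \<in> vf"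
  shows "lie_bracket (X + Y) Z = lie_bracket X Z + lie_bracket Y Z"
proof (intro ext)
  fix p h
  note Z = vfD(1)[OF assms(3), of p]
  show "lie_bracket (X + Y) Z p h = (lie_bracket X Z + lie_bracket Y Z) p h"
  \<comment> \<open>The derivation rules hold on smooth functions only; elsewhere both sides are 0
    because all the fields involved take the default value.\<close>
  proof (cases "h \<in> sf")
    case True
    then show ?thesis
      using tangentD(1)[OF Z vfD(2)[OF assms(1) True] vfD(2)[OF assms(2) True]] by (simp add: lie_bracket_def)
  next
    case False
    have z: "V p h = 0" if "V \<in> vf" for V using tangentD(4)[OF vfD(1)[OF that] False] .
    show ?thesis
      using z[OF vf_lie_bracket[OF vf_add[OF assms(1,2)] assms(3)]] z[OF vf_lie_bracket[OF assms(1,3)]]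
        z[OF vf_lie_bracket[OF assms(2,3)]] by simp
  qed
qed

lemma lie_bracket_scale:
  assumes "f \<in> sf" "X \<in> vf" "Y \<in> vf"
  shows "lie_bracket (scale_field f X) Y = scale_field f (lie_bracket X Y) - scale_field (\<lambda>p. Y p f) X"
proof (intro ext)
  fix p h
  note Y = vfD(1)[OF assms(3), of p]
  show "lie_bracket (scale_field f X) Y p h = (scale_field f (lie_bracket X Y) - scale_field (\<lambda>p. Y p f) X) p h"
  proof (cases "h \<in> sf")
    case True
    then show ?thesis
      using tangentD(3)[OF Y assms(1) vfD(2)[OF assms(2) True]]
      by (simp add: lie_bracket_def scale_field_def scale_def algebra_simps)
  next
    case False
    have "lie_bracket (scale_field f X) Y p h = 0" "lie_bracket X Y p h = 0" "X p h = 0"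
      using tangentD(4)[OF vfD(1) False] vf_lie_bracket vf_scale assms by auto
    then show ?thesis by (simp add: scale_field_def scale_def)
  qed
qed

lemma lie_bracket_anti: "lie_bracket X Y = - lie_bracket Y X"
  by (auto simp: lie_bracket_def fun_eq_iff)

lemma jacobi:
  assumes X: "X \<in> vf" and Y: "Y \<in> vf" and Z: "Z \<in> vf"
  shows "lie_bracket X (lie_bracket Y Z) + lie_bracket Y (lie_bracket Z X) + lie_bracket Z (lie_bracket X Y) = 0"
proof (intro ext)
  fix p h
  note in_TS = vfD(1)[OF X, of p] vfD(1)[OF Y, of p] vfD(1)[OF Z, of p]
  note in_sf = vfD(2)[OF X] vfD(2)[OF Y] vfD(2)[OF Z]
  show "(lie_bracket X (lie_bracket Y Z) + lie_bracket Y (lie_bracket Z X) + lie_bracket Z (lie_bracket X Y)) p h =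
      (0 :: 'm vfield) p h"
  proof (cases "h \<in> sf")
    case True
    then show ?thesis
      by (simp add: lie_bracket_def tangent_diff[OF in_TS(1)] tangent_diff[OF in_TS(2)] tangent_diff[OF in_TS(3)] in_sf)
  next
    case False
    have z: "V p h = 0" if "V \<in> vf" for V using tangentD(4)[OF vfD(1)[OF that] False] .
    show ?thesis
      using z[OF vf_lie_bracket[OF X vf_lie_bracket[OF Y Z]]] z[OF vf_lie_bracket[OF Y vf_lie_bracket[OF Z X]]]
        z[OF vf_lie_bracket[OF Z vf_lie_bracket[OF X Y]]] by simp
  qed
qed

section \<open>Tensoriality of the curvature operator\<close>

abbreviation "curv \<equiv> curvature nabla"

lemma nabla_uminus: "X \<in> vf \<Longrightarrow> Z \<in> vf \<Longrightarrow> nabla (- X) Z = - nabla X Z"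
  using nabla_diff(1)[OF vf_0, of X Z] nabla_diff(1)[of X X Z] by simp

lemma curv_vf: "X \<in> vf \<Longrightarrow> Y \<in> vf \<Longrightarrow> Z \<in> vf \<Longrightarrow> curv X Y Z \<in> vf"
  unfolding curvature_def by (intro vf_diff nabla_vf vf_lie_bracket)

lemma curv_anti: "X \<in> vf \<Longrightarrow> Y \<in> vf \<Longrightarrow> Z \<in> vf \<Longrightarrow> curv X Y Z = - curv Y X Z"
  unfolding curvature_def lie_bracket_anti[of Y X] by (simp add: nabla_uminus vf_lie_bracket)

lemma curv_add1:
  assumes "X \<in> vf" "X' \<in> vf" "Y \<in> vf" "Z \<in> vf"
  shows "curv (X + X') Y Z = curv X Y Z + curv X' Y Z"
  using assms by (simp add: curvature_def lie_bracket_add nabla_add nabla_vf vf_lie_bracket del: plus_fun_apply)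

text \<open>The term with Y(f) that arises from differentiating f \<nabla>_X Z along Y cancels the
  one produced by the bracket of f X with Y.\<close>

lemma curv_scale1:
  assumes "f \<in> sf" "X \<in> vf" "Y \<in> vf" "Z \<in> vf"
  shows "curv (scale_field f X) Y Z = scale_field f (curv X Y Z)"
proof -
  have "curv (scale_field f X) Y Z = scale_field f (nabla X (nabla Y Z))
      - (scale_field (\<lambda>p. Y p f) (nabla X Z) + scale_field f (nabla Y (nabla X Z)))
      - (scale_field f (nabla (lie_bracket X Y) Z) - scale_field (\<lambda>p. Y p f) (nabla X Z))"
    using assms
    by (simp add: curvature_def lie_bracket_scale nabla_diff nabla_scale nabla_vf vf_lie_bracket vf_scale vfD(2)
        del: plus_fun_apply minus_apply)
  also have "\<dots> = scale_field f (curv X Y Z)"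
    by (auto simp: curvature_def scale_field_def scale_def fun_eq_iff algebra_simps)
  finally show ?thesis .
qed

lemma curv_add2:
  assumes "X \<in> vf" "Y \<in> vf" "Y' \<in> vf" "Z \<in> vf"
  shows "curv X (Y + Y') Z = curv X Y Z + curv X Y' Z"
  using assms by (simp add: curv_anti[of X] curv_add1 vf_add del: plus_fun_apply)

lemma curv_scale2:
  assumes "f \<in> sf" "X \<in> vf" "Y \<in> vf" "Z \<in> vf"
  shows "curv X (scale_field f Y) Z = scale_field f (curv X Y Z)"
  using assms by (simp add: curv_anti[of X] curv_scale1 vf_scale) (auto simp: scale_field_def scale_def fun_eq_iff)

lemma curv_add3:
  assumes "X \<in> vf" "Y \<in> vf" "Z \<in> vf" "Z' \<in> vf"
  shows "curv X Y (Z + Z') = curv X Y Z + curv X Y Z'"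
  using assms by (simp add: curvature_def nabla_add nabla_vf vf_lie_bracket del: plus_fun_apply)

text \<open>The second derivatives of f combine to X(Y f) - Y(X f), which the bracket term removes;
  the mixed first-order terms are symmetric in X and Y.\<close>

lemma curv_scale3:
  assumes "f \<in> sf" "X \<in> vf" "Y \<in> vf" "Z \<in> vf"
  shows "curv X Y (scale_field f Z) = scale_field f (curv X Y Z)"
proof -
  have second: "nabla X (nabla Y (scale_field f Z)) =
      scale_field (\<lambda>p. X p (\<lambda>q. Y q f)) Z + scale_field (\<lambda>p. Y p f) (nabla X Z)
      + (scale_field (\<lambda>p. X p f) (nabla Y Z) + scale_field f (nabla X (nabla Y Z)))"
    if "X \<in> vf" "Y \<in> vf" for X Y
    using assms that vfD(2)[OF that(2) assms(1)] vfD(2)[OF that(1) assms(1)]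
    by (simp add: nabla_add nabla_scale nabla_vf vf_scale del: plus_fun_apply)
  have "nabla (lie_bracket X Y) (scale_field f Z) =
      scale_field (\<lambda>p. lie_bracket X Y p f) Z + scale_field f (nabla (lie_bracket X Y) Z)"
    using assms by (simp add: nabla_scale vf_lie_bracket del: plus_fun_apply)
  then show ?thesis
    unfolding curvature_def second[OF assms(2,3)] second[OF assms(3,2)]
    by (auto simp: lie_bracket_def scale_field_def scale_def fun_eq_iff algebra_simps)
qed

section \<open>Curvature on tangent vectors at a point\<close>

abbreviation "Rm \<equiv> curvature_at A nabla"

text \<open>The chosen extensions are exchanged for the given fields one slot at a time. Evaluation
  at a function h turns each slot into a real-valued functional, as \<open>tensorial_eq\<close>
  requires.\<close>

lemma curvature_at_eq:
  assumes "X \<in> vf" "Y \<in> vf" "Z \<in> vf"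
  shows "Rm p (X p) (Y p) (Z p) = curv X Y Z p"
proof
  fix h
  define X' Y' Z' where "X' = extension A p (X p)" and "Y' = extension A p (Y p)" and "Z' = extension A p (Z p)"
  have X': "X' \<in> vf" "X' p = X p" and Y': "Y' \<in> vf" "Y' p = Y p" and Z': "Z' \<in> vf" "Z' p = Z p"
    using vf_extension assms vfD(1) unfolding X'_def Y'_def Z'_def by blast+
  have "curv X' Y' Z' p h = curv X Y' Z' p h"
    using X' Y' Z' assms
    by (intro tensorial_eq[of "\<lambda>X. curv X Y' Z' p h" p]) (simp_all add: curv_add1 curv_scale1 scale_field_apply)
  also have "\<dots> = curv X Y Z' p h"
    using X' Y' Z' assms
    by (intro tensorial_eq[of "\<lambda>Y. curv X Y Z' p h" p]) (simp_all add: curv_add2 curv_scale2 scale_field_apply)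
  also have "\<dots> = curv X Y Z p h"
    using X' Y' Z' assms
    by (intro tensorial_eq[of "\<lambda>Z. curv X Y Z p h" p]) (simp_all add: curv_add3 curv_scale3 scale_field_apply)
  finally show "Rm p (X p) (Y p) (Z p) h = curv X Y Z p h"
    by (simp add: curvature_at_def X'_def Y'_def Z'_def)
qed

lemma tangent_field:
  assumes "v \<in> TS p"
  obtains X where "X \<in> vf" "X p = v"
  using vf_extension[OF assms] by blast

lemma curvature_at_tangent:
  assumes "u \<in> TS p" "v \<in> TS p" "w \<in> TS p"
  shows "Rm p u v w \<in> TS p"
  unfolding curvature_at_def by (intro vfD(1) curv_vf vf_extension assms)

text \<open>The chosen extension of a sum need not be the sum of the chosen extensions, so linearity
  is read off from other fields by means of \<open>curvature_at_eq\<close>.\<close>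

lemma curvature_at_linear:
  assumes "v \<in> TS p" "w \<in> TS p"
  shows "linear_on_space (TS p) (\<lambda>u. Rm p u v w)" "linear_on_space (TS p) (\<lambda>u. Rm p v u w)"
    "linear_on_space (TS p) (\<lambda>u. Rm p v w u)"
proof -
  obtain Y where Y: "Y \<in> vf" "Y p = v" using tangent_field[OF assms(1)] .
  obtain Z where Z: "Z \<in> vf" "Z p = w" using tangent_field[OF assms(2)] .
  note YZ = Y(2)[symmetric] Z(2)[symmetric]
  have add: "Rm p (u + u') v w = Rm p u v w + Rm p u' v w \<and> Rm p v (u + u') w = Rm p v u w + Rm p v u' w \<and>
      Rm p v w (u + u') = Rm p v w u + Rm p v w u'" if u: "u \<in> TS p" "u' \<in> TS p" for u u'
  proof -
    obtain X where X: "X \<in> vf" "X p = u" using tangent_field[OF u(1)] .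
    obtain X' where X': "X' \<in> vf" "X' p = u'" using tangent_field[OF u(2)] .
    have XX': "u + u' = (X + X') p" using X X' by simp
    show ?thesis
      unfolding XX' unfolding YZ X(2)[symmetric] X'(2)[symmetric]
      using X(1) X'(1) Y(1) Z(1)
      by (simp only: curvature_at_eq vf_add curv_add1 curv_add2 curv_add3 plus_fun_apply[of "curv _ _ _"] simp_thms)
  qed
  have scale: "Rm p (scale a u) v w = scale a (Rm p u v w) \<and> Rm p v (scale a u) w = scale a (Rm p v u w) \<and>
      Rm p v w (scale a u) = scale a (Rm p v w u)" if u: "u \<in> TS p" for a u
  proof -
    obtain X where X: "X \<in> vf" "X p = u" using tangent_field[OF u(1)] .
    let ?X = "scale_field (\<lambda>_. a) X"
    have sc: "scale_field (\<lambda>_. a) V p = scale a (V p)" for V :: "'m vfield" by (simp add: scale_field_def)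
    have "Rm p (?X p) (Y p) (Z p) = scale_field (\<lambda>_. a) (curv X Y Z) p"
      "Rm p (Y p) (?X p) (Z p) = scale_field (\<lambda>_. a) (curv Y X Z) p"
      "Rm p (Y p) (Z p) (?X p) = scale_field (\<lambda>_. a) (curv Y Z X) p"
      using X(1) Y(1) Z(1) by (simp_all only: curvature_at_eq vf_scale sf_const curv_scale1 curv_scale2 curv_scale3)
    then show ?thesis
      unfolding sc X(2) Y(2) Z(2) using curvature_at_eq[of _ _ _ p] X(1) Y(1) Z(1)
      by (simp only: YZ X(2)[symmetric] simp_thms)
  qed
  show "linear_on_space (TS p) (\<lambda>u. Rm p u v w)" "linear_on_space (TS p) (\<lambda>u. Rm p v u w)"
    "linear_on_space (TS p) (\<lambda>u. Rm p v w u)"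
    unfolding linear_on_space_def using add scale by blast+
qed

lemma curvature_at_anti:
  assumes "u \<in> TS p" "v \<in> TS p" "w \<in> TS p"
  shows "Rm p u v w = - Rm p v u w"
  using fun_cong[OF curv_anti[OF vf_extension(1)[OF assms(1)] vf_extension(1)[OF assms(2)] vf_extension(1)[OF assms(3)]], of p]
  by (simp add: curvature_at_def)

text \<open>Using torsion-freeness twice rewrites a double bracket in covariant derivatives; the
  Jacobi identity then becomes the cyclic sum of curvatures.\<close>

lemma curvature_at_bianchi:
  assumes "u \<in> TS p" "v \<in> TS p" "w \<in> TS p"
  shows "Rm p u v w + Rm p v w u + Rm p w u v = 0"
proof -
  obtain X where X: "X \<in> vf" "X p = u" using tangent_field[OF assms(1)] .
  obtain Y where Y: "Y \<in> vf" "Y p = v" using tangent_field[OF assms(2)] .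
  obtain Z where Z: "Z \<in> vf" "Z p = w" using tangent_field[OF assms(3)] .
  have br: "lie_bracket V (lie_bracket V' V'') = nabla V (nabla V' V'') - nabla V (nabla V'' V') - nabla (lie_bracket V' V'') V"
    if "V \<in> vf" "V' \<in> vf" "V'' \<in> vf" for V V' V''
    using torsion_free[OF that(1) vf_lie_bracket[OF that(2,3)]] that
    by (simp only: torsion_free[OF that(2,3), symmetric] nabla_diff nabla_vf)
  have "curv X Y Z + curv Y Z X + curv Z X Y = 0"
    using jacobi[OF X(1) Y(1) Z(1)] br[OF X(1) Y(1) Z(1)] br[OF Y(1) Z(1) X(1)] br[OF Z(1) X(1) Y(1)]
    unfolding curvature_def by (simp add: algebra_simps del: plus_fun_apply minus_apply)
  then have "(curv X Y Z + curv Y Z X + curv Z X Y) p = 0" by (simp only: zero_fun_apply)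
  then show ?thesis
    unfolding X(2)[symmetric] Y(2)[symmetric] Z(2)[symmetric]
    by (simp only: plus_fun_apply curvature_at_eq X(1) Y(1) Z(1))
qed

text \<open>The operator XY - YX - [X, Y] annihilates the function g(Z, W). Expanded by metric
  compatibility, the terms with one derivative on each factor cancel and the curvature terms
  remain.\<close>

lemma curvature_at_skew:
  assumes "u \<in> TS p" "v \<in> TS p" "w \<in> TS p" "z \<in> TS p"
  shows "g p (Rm p u v w) z = - g p (Rm p u v z) w"
proof -
  obtain X where X: "X \<in> vf" "X p = u" using tangent_field[OF assms(1)] .
  obtain Y where Y: "Y \<in> vf" "Y p = v" using tangent_field[OF assms(2)] .
  obtain Z where Z: "Z \<in> vf" "Z p = w" using tangent_field[OF assms(3)] .
  obtain W where W: "W \<in> vf" "W p = z" using tangent_field[OF assms(4)] .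
  let ?G = "app02 g"
  have second: "X p (\<lambda>q. Y q (?G Z W)) =
      g p (nabla X (nabla Y Z) p) (W p) + g p (nabla Y Z p) (nabla X W p)
      + (g p (nabla X Z p) (nabla Y W p) + g p (Z p) (nabla X (nabla Y W) p))"
    if "X \<in> vf" "Y \<in> vf" for X Y
  proof -
    have "(\<lambda>q. Y q (?G Z W)) = (\<lambda>q. ?G (nabla Y Z) W q + ?G Z (nabla Y W) q)"
      using metric_compatible[OF that(2) Z(1) W(1)] by auto
    then have "X p (\<lambda>q. Y q (?G Z W)) = X p (?G (nabla Y Z) W) + X p (?G Z (nabla Y W))"
      using tangentD(1)[OF vfD(1)[OF that(1)] metric_sf[OF nabla_vf[OF that(2) Z(1)] W(1)]
          metric_sf[OF Z(1) nabla_vf[OF that(2) W(1)]]] by simp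
    then show ?thesis using that Z(1) W(1) by (simp add: metric_compatible nabla_vf)
  qed
  have "X p (\<lambda>q. Y q (?G Z W)) - Y p (\<lambda>q. X q (?G Z W)) =
      g p (nabla (lie_bracket X Y) Z p) (W p) + g p (Z p) (nabla (lie_bracket X Y) W p)"
    using metric_compatible[OF vf_lie_bracket[OF X(1) Y(1)] Z(1) W(1), of p] by (simp add: lie_bracket_def)
  moreover have "g p (curv X Y Z p) (W p) = g p (nabla X (nabla Y Z) p) (W p)
      - g p (nabla Y (nabla X Z) p) (W p) - g p (nabla (lie_bracket X Y) Z p) (W p)"
    using X(1) Y(1) Z(1) W(1)
    by (simp add: curvature_def metric_left tangent_minus vfD(1) nabla_vf vf_lie_bracket)
  moreover have "g p (curv X Y W p) (Z p) = g p (Z p) (nabla X (nabla Y W) p)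
      - g p (Z p) (nabla Y (nabla X W) p) - g p (Z p) (nabla (lie_bracket X Y) W p)"
    unfolding metricD(2)[OF vfD(1)[OF curv_vf[OF X(1) Y(1) W(1)]] vfD(1)[OF Z(1)]]
    using X(1) Y(1) Z(1) W(1)
    by (simp add: curvature_def metric_right tangent_minus vfD(1) nabla_vf vf_lie_bracket)
  ultimately have "g p (curv X Y Z p) (W p) = - g p (curv X Y W p) (Z p)"
    using second[OF X(1) Y(1)] second[OF Y(1) X(1)] by linarith
  then show ?thesis
    unfolding X(2)[symmetric] Y(2)[symmetric] Z(2)[symmetric] W(2)[symmetric]
    by (simp only: curvature_at_eq X(1) Y(1) Z(1) W(1))
qed

end

section \<open>Quasi-para-Sasakian manifolds of dimension 3\<close>

locale quasi_para_sasakian_3 = levi_civita_manifold A g nabla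
  for A :: "('m::{t2_space, second_countable_topology}, real ^ 3) chart set"
    and g :: "'m tensor02" and nabla :: "'m connection" +
  fixes \<phi> :: "'m tensor11" and \<eta> :: "'m tensor01" and \<xi> :: "'m vfield"
  assumes qps: "quasi_para_sasakian A \<phi> \<eta> \<xi> g nabla"
begin

lemma structure_props:
  shows "endomorphism_field A \<phi>" "one_form A \<eta>" "\<xi> \<in> vf" "\<phi> p (\<xi> p) = 0" "\<eta> p (\<xi> p) = 1"
    "v \<in> TS p \<Longrightarrow> \<eta> p (\<phi> p v) = 0" "v \<in> TS p \<Longrightarrow> \<phi> p (\<phi> p v) = v - scale (\<eta> p v) (\<xi> p)"
    "v \<in> TS p \<Longrightarrow> w \<in> TS p \<Longrightarrow> g p (\<phi> p v) (\<phi> p w) = - g p v w + \<eta> p v * \<eta> p w"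
  using qps unfolding quasi_para_sasakian_def almost_paracontact_metric_manifold_def by blast+

lemma \<phi>_vf: "X \<in> vf \<Longrightarrow> app11 \<phi> X \<in> vf"
  using structure_props(1) unfolding endomorphism_field_def by blast

lemma paracontact_space: "paracontact_space (TS p) (\<phi> p) (\<eta> p) (\<xi> p) (g p)"
proof unfold_locales
  show "functional.subspace (TS p)" by (rule tangent_subspace)
  obtain B where "functional.independent B" "functional.span B = TS p" "finite B" "card B = DIM(real ^ 3)"
    by (rule tangent_basis[of p])
  then show "\<exists>B. functional.independent B \<and> functional.span B = TS p \<and> finite B \<and> card B = 3"
    by (intro exI[of _ B]) simp
  show "linear_on_space (TS p) (\<phi> p)" "\<And>v. v \<in> TS p \<Longrightarrow> \<phi> p v \<in> TS p"
    using structure_props(1) unfolding endomorphism_field_def by blast+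
  show "linear_form_on (TS p) (\<eta> p)" using structure_props(2) unfolding one_form_def by blast
  show "linear_form_on (TS p) (g p v)" if "v \<in> TS p" for v by (rule metricD(1)[OF that])
  show "g p v w = g p w v" if "v \<in> TS p" "w \<in> TS p" for v w by (rule metricD(2)[OF that])
  show "v = 0" if "v \<in> TS p" "\<And>w. w \<in> TS p \<Longrightarrow> g p v w = 0" for v by (rule metricD(3)[OF that])
  show "\<xi> p \<in> TS p" "\<phi> p (\<xi> p) = 0" "\<eta> p (\<xi> p) = 1"
    by (rule vfD(1)[OF structure_props(3)] structure_props)+
qed (rule structure_props; assumption)+

lemma nabla_\<phi>:
  assumes "X \<in> vf" "Y \<in> vf"
  shows "nabla X (app11 \<phi> Y) p = \<phi> p (nabla X Y p) + (scale (g p (X p) (Y p)) (\<xi> p) - scale (\<eta> p (Y p)) (X p))"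
proof -
  have "cov_deriv11 nabla \<phi> X Y = scale_field (app02 g X Y) \<xi> - scale_field (app01 \<eta> Y) X"
    using qps assms unfolding quasi_para_sasakian_def by blast
  from fun_cong[OF this, of p] show ?thesis
    by (simp add: cov_deriv11_def scale_field_def algebra_simps)
qed

text \<open>The structure equation with Y = \<xi> determines \<phi>(\<nabla>_X \<xi>), and applying
  \<phi> once more recovers \<nabla>_X \<xi> up to its \<xi> component.\<close>

lemma nabla_\<xi>:
  assumes X: "X \<in> vf"
  shows "nabla X \<xi> = app11 \<phi> X"
proof
  fix p
  interpret paracontact_space "TS p" "\<phi> p" "\<eta> p" "\<xi> p" "g p" by (rule paracontact_space)
  note \<xi>_vf = structure_props(3)
  have T: "nabla X \<xi> p \<in> TS p" "X p \<in> TS p" using X \<xi>_vf by (simp_all add: vfD(1) nabla_vf)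
  have z: "app11 \<phi> \<xi> = 0" using structure_props(4) by auto
  have "nabla X 0 = 0" using nabla_diff(2)[OF X X X] by simp
  then have "0 = \<phi> p (nabla X \<xi> p) + (scale (\<eta> p (X p)) (\<xi> p) - X p)"
    using nabla_\<phi>[OF X \<xi>_vf, of p] T(2) unfolding z by (simp add: g_\<xi> \<xi> functional.scale_one)
  then have "\<phi> p (nabla X \<xi> p) = X p - scale (\<eta> p (X p)) (\<xi> p)"
    by (simp only: add_diff_eq eq_diff_eq eq_iff_diff_eq_0[of "_ + _"] add_0_left)
  then have "\<phi> p (\<phi> p (nabla X \<xi> p)) = \<phi> p (X p - scale (\<eta> p (X p)) (\<xi> p))" by simp
  also have "\<dots> = \<phi> p (X p)"
  proof -
    have "X p - scale (\<eta> p (X p)) (\<xi> p) = X p + scale (- \<eta> p (X p)) (\<xi> p)" by (auto simp: scale_def)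
    then have "\<phi> p (X p - scale (\<eta> p (X p)) (\<xi> p)) = \<phi> p (X p) + scale (- \<eta> p (X p)) (\<phi> p (\<xi> p))"
      using \<phi>(1) T(2) \<xi>(1) V_scale unfolding linear_on_space_def by metis
    then show ?thesis by (simp add: \<xi>(2) functional.scale_zero_right)
  qed
  finally have *: "nabla X \<xi> p - scale (\<eta> p (nabla X \<xi> p)) (\<xi> p) = \<phi> p (X p)"
    using \<phi>\<phi>[OF T(1)] by simp
  \<comment> \<open>Since \<xi> has constant length, \<nabla>_X \<xi> is orthogonal to it, which
    settles the missing component.\<close>
  have "app02 g \<xi> \<xi> = (\<lambda>q. 1)"
  proof
    fix q
    interpret q: paracontact_space "TS q" "\<phi> q" "\<eta> q" "\<xi> q" "g q" by (rule paracontact_space)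
    show "app02 g \<xi> \<xi> q = 1" using q.g_\<xi>(1)[OF q.\<xi>(1)] q.\<xi>(3) by simp
  qed
  then have "g p (nabla X \<xi> p) (\<xi> p) + g p (\<xi> p) (nabla X \<xi> p) = 0"
    using metric_compatible[OF X \<xi>_vf \<xi>_vf, of p] tangent_const[OF T(2)] by simp
  then have "\<eta> p (nabla X \<xi> p) = 0" using T(1) by (simp add: g_\<xi>)
  then show "nabla X \<xi> p = \<phi> p (X p)" using * by (simp add: functional.scale_zero_left)
qed

text \<open>With \<nabla> \<xi> = \<phi> and vanishing torsion, the curvature is (\<nabla>_X \<phi>)
  Y - (\<nabla>_Y \<phi>) X; the metric term of the structure equation is symmetric and drops
  out.\<close>

lemma curvature_at_\<xi>:
  assumes "u \<in> TS p" "v \<in> TS p"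
  shows "Rm p u v (\<xi> p) = scale (\<eta> p u) v - scale (\<eta> p v) u"
proof -
  interpret paracontact_space "TS p" "\<phi> p" "\<eta> p" "\<xi> p" "g p" by (rule paracontact_space)
  obtain X where X: "X \<in> vf" "X p = u" using tangent_field[OF assms(1)] .
  obtain Y where Y: "Y \<in> vf" "Y p = v" using tangent_field[OF assms(2)] .
  note in_TS = vfD(1)[OF X(1), of p] vfD(1)[OF Y(1), of p]
  have T: "nabla X Y p \<in> TS p" "nabla Y X p \<in> TS p" using X Y by (simp_all add: vfD(1) nabla_vf)
  have "nabla X Y p = lie_bracket X Y p + nabla Y X p"
    using torsion_free[OF X(1) Y(1)] by (metis diff_add_cancel plus_fun_apply)
  then have lie: "\<phi> p (nabla X Y p) = \<phi> p (lie_bracket X Y p) + \<phi> p (nabla Y X p)"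
    using \<phi>(1) T vfD(1)[OF vf_lie_bracket[OF X(1) Y(1)], of p] unfolding linear_on_space_def by metis
  have "curv X Y \<xi> p = nabla X (app11 \<phi> Y) p - nabla Y (app11 \<phi> X) p - \<phi> p (lie_bracket X Y p)"
    using X Y by (simp add: curvature_def nabla_\<xi> vf_lie_bracket)
  also have "\<dots> = scale (\<eta> p (X p)) (Y p) - scale (\<eta> p (Y p)) (X p)"
    unfolding nabla_\<phi>[OF X(1) Y(1)] nabla_\<phi>[OF Y(1) X(1)] lie g(2)[OF in_TS] by (simp add: algebra_simps)
  finally show ?thesis
    using curvature_at_eq[OF X(1) Y(1) structure_props(3), of p] X(2) Y(2) by simp
qed

text \<open>Solves scal = 2 \<sigma> - 2, so constancy of \<sigma> and of \<open>scal\<close> are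
  equivalent; \<sigma> is the eigenvalue of the Ricci operator on ker \<eta>.\<close>

definition \<sigma> :: "'m \<Rightarrow> real" where
  "\<sigma> p = (scal A g nabla p + 2) / 2"

text \<open>The algebraic lemma supplies some t at each point, and its scalar curvature identity
  forces t = \<sigma> p.\<close>

lemma \<sigma>_props:
  shows "v \<in> TS p \<Longrightarrow> w \<in> TS p \<Longrightarrow> Ric A nabla p v w = \<sigma> p * g p v w - (\<sigma> p + 2) * \<eta> p v * \<eta> p w"
    and "u \<in> TS p \<Longrightarrow> \<eta> p u = 0 \<Longrightarrow> g p (Rm p u (\<phi> p u) u) (\<phi> p u) = (\<sigma> p + 1) * (g p u u)\<^sup>2"
    and "\<exists>u\<in>TS p. g p (\<phi> p u) (\<phi> p u) \<noteq> 0"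
proof -
  interpret paracontact_space "TS p" "\<phi> p" "\<eta> p" "\<xi> p" "g p" by (rule paracontact_space)
  obtain t where t:
    "\<And>v w. v \<in> TS p \<Longrightarrow> w \<in> TS p \<Longrightarrow> trace_on (TS p) (\<lambda>u. Rm p u v w) = t * g p v w - (t + 2) * \<eta> p v * \<eta> p w"
    "metric_trace_on (TS p) (g p) (\<lambda>v w. trace_on (TS p) (\<lambda>u. Rm p u v w)) = 2 * t - 2"
    "\<And>u. u \<in> TS p \<Longrightarrow> \<eta> p u = 0 \<Longrightarrow> g p (Rm p u (\<phi> p u) u) (\<phi> p u) = (t + 1) * (g p u u)\<^sup>2"
    "\<exists>u\<in>TS p. g p (\<phi> p u) (\<phi> p u) \<noteq> 0"
    using sasakian_curvature[of "Rm p", OF curvature_at_tangent curvature_at_linear(1,2,3) curvature_at_anti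
        curvature_at_skew curvature_at_bianchi curvature_at_\<xi>] by blast
  have Ric: "Ric A nabla p = (\<lambda>v w. trace_on (TS p) (\<lambda>u. Rm p u v w))" by (intro ext) (simp add: Ric_def)
  have st: "\<sigma> p = t" using t(2) by (simp add: \<sigma>_def scal_def Ric)
  show "v \<in> TS p \<Longrightarrow> w \<in> TS p \<Longrightarrow> Ric A nabla p v w = \<sigma> p * g p v w - (\<sigma> p + 2) * \<eta> p v * \<eta> p w"
    unfolding st Ric by (rule t(1))
  show "u \<in> TS p \<Longrightarrow> \<eta> p u = 0 \<Longrightarrow> g p (Rm p u (\<phi> p u) u) (\<phi> p u) = (\<sigma> p + 1) * (g p u u)\<^sup>2"
    unfolding st by (rule t(3))
  show "\<exists>u\<in>TS p. g p (\<phi> p u) (\<phi> p u) \<noteq> 0" by (rule t(4))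
qed

text \<open>Tangent vectors are 0 on non-smooth functions, so \<open>X(\<sigma>)\<close> says nothing until \<open>\<sigma>\<close> is known to be smooth;
  the quotient \<open>W / H\<close> avoids that question.\<close>

lemma \<sigma>_ratio:
  assumes parallel: "eta_parallel_Ricci A \<phi> nabla"
  shows "\<exists>W\<in>sf. \<exists>H\<in>sf. (\<forall>q. W q = \<sigma> q * H q) \<and> H p \<noteq> 0 \<and> (\<forall>v\<in>TS p. v W = \<sigma> p * v H)"
proof -
  obtain u where u: "u \<in> TS p" "g p (\<phi> p u) (\<phi> p u) \<noteq> 0" using \<sigma>_props(3) by blast
  obtain Y where Y: "Y \<in> vf" "Y p = u" using tangent_field[OF u(1)] .
  define U where "U = app11 \<phi> Y"
  define N where "N = app02 g U U"
  define F where "F = app02 g (curv U (app11 \<phi> U) U) (app11 \<phi> U)"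
  \<comment> \<open>As F = (\<sigma> + 1) N^2, the difference F - N^2 is \<sigma> N^2, assembled
    from smooth functions.\<close>
  define W where "W = (\<lambda>q. (F q - N q * N q) * N q)"
  define H where "H = (\<lambda>q. (N q * N q) * N q)"
  \<comment> \<open>The weight N^2 turns g(\<phi> Y1, U) into H = N^3, hence the Ricci value on this
    pair into W.\<close>
  define Y1 where "Y1 = scale_field (\<lambda>q. N q * N q) Y"
  define U1 where "U1 = scale_field (\<lambda>q. N q * N q) U"
  have U: "U \<in> vf" "\<And>q. \<eta> q (U q) = 0" unfolding U_def using \<phi>_vf Y structure_props(6) vfD(1) by auto
  have N: "N \<in> sf" "N p \<noteq> 0" using U Y u by (simp_all add: N_def metric_sf) (simp add: U_def)
  have NN: "(\<lambda>q. N q * N q) \<in> sf" by (intro sf_mult N)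
  have F: "F \<in> sf" unfolding F_def by (intro metric_sf curv_vf \<phi>_vf U)
  have Y1: "Y1 \<in> vf" and U1: "U1 \<in> vf" unfolding Y1_def U1_def using NN U Y by (simp_all add: vf_scale)
  have FN: "F q = (\<sigma> q + 1) * (N q)\<^sup>2" for q
    using \<sigma>_props(2)[OF vfD(1)[OF U(1)] U(2), of q] curvature_at_eq[OF U(1) \<phi>_vf[OF U(1)] U(1), of q]
    by (simp add: F_def N_def)
  have WH: "W q = \<sigma> q * H q" for q by (simp add: W_def H_def FN power2_eq_square algebra_simps)
  have U1_eq: "app11 \<phi> Y1 = U1"
  proof
    fix q
    interpret paracontact_space "TS q" "\<phi> q" "\<eta> q" "\<xi> q" "g q" by (rule paracontact_space)
    show "\<phi> q (Y1 q) = U1 q"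
      using \<phi>(1) vfD(1)[OF Y(1), of q] unfolding Y1_def U1_def U_def scale_field_def linear_on_space_def by blast
  qed
  have gU1: "app02 g U1 U = H"
    by (simp add: U1_def H_def N_def scale_field_def metric_left(2)[OF vfD(1)[OF U(1)] vfD(1)[OF U(1)] tangent_0])
  \<comment> \<open>Here v stays arbitrary: covariant derivatives of horizontal fields in general
    have a \<xi> component.\<close>
  have ric: "Ric A nabla q v (U q) = \<sigma> q * g q v (U q)" "Ric A nabla q (U q) v = \<sigma> q * g q (U q) v" if "v \<in> TS q" for q v
    using that by (simp_all add: \<sigma>_props(1) vfD(1) U)
  have U1\<eta>: "\<eta> q (U1 q) = 0" for q
  proof -
    show ?thesis unfolding U1_eq[symmetric] by (rule structure_props(6)[OF vfD(1)[OF Y1]])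
  qed
  have "v W = \<sigma> p * v H" if v: "v \<in> TS p" for v
  proof -
    obtain X where X: "X \<in> vf" "X p = v" using tangent_field[OF v] .
    have "app02 (Ric A nabla) U1 U = W"
      using WH vfD(1)[OF U1] fun_cong[OF gU1] by (auto simp: ric)
    moreover have "cov_deriv02 nabla (Ric A nabla) X U1 U p = 0"
      using parallel X(1) Y(1) Y1 unfolding eta_parallel_Ricci_def U1_eq[symmetric] U_def by simp
    ultimately have "X p W = Ric A nabla p (nabla X U1 p) (U p) + Ric A nabla p (U1 p) (nabla X U p)"
      by (simp add: cov_deriv02_def)
    also have "\<dots> = \<sigma> p * (g p (nabla X U1 p) (U p) + g p (U1 p) (nabla X U p))"
      using X(1) U U1 by (simp add: \<sigma>_props(1) vfD(1) nabla_vf U1\<eta> algebra_simps)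
    also have "\<dots> = \<sigma> p * X p H"
      using metric_compatible[OF X(1) U1 U(1), of p] unfolding gU1 by simp
    finally show ?thesis unfolding X(2) .
  qed
  moreover have "W \<in> sf" "H \<in> sf" unfolding W_def H_def by (intro sf_mult sf_diff F N NN)+
  ultimately show ?thesis using WH N(2) by (intro bexI[of _ W] bexI[of _ H]) (auto simp: H_def)
qed

end

theorem proposition6p6:
  fixes A :: "('m::{t2_space, second_countable_topology}, real ^ 3) chart set"
    and \<phi> :: "'m tensor11" and \<eta> :: "'m tensor01" and \<xi> :: "'m vfield" and g :: "'m tensor02"
    and nabla :: "'m connection"
  assumes "connected (UNIV :: 'm set)"
    and "levi_civita_connection A g nabla"
    and "quasi_para_sasakian A \<phi> \<eta> \<xi> g nabla"
    and "eta_parallel_Ricci A \<phi> nabla"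
  shows "\<exists>c. \<forall>p. scal A g nabla p = c"
proof -
  have "smooth_manifold A" "pseudo_riemannian_metric A g"
    using assms(3) unfolding quasi_para_sasakian_def almost_paracontact_metric_manifold_def by blast+
  then interpret quasi_para_sasakian_3 A g nabla \<phi> \<eta> \<xi>
    using assms by unfold_locales
  obtain c where "\<And>p. \<sigma> p = c"
    using locally_constant_ratio[OF assms(1) \<sigma>_ratio[OF assms(4)]] by blast
  then have "scal A g nabla p = 2 * c - 2" for p by (simp add: \<sigma>_def field_simps)
  then show ?thesis by blast
qed

end
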